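(* Let $(V,g)$ be a $4$-dimensional real inner product space (identified with oriented Euclidean $\mathbb{R}^4$). The Kulkarni--Nomizu product $\wedge_{KN}$ of symmetric bilinear forms on $V$ satisfies the following. (i) Commutativity: $h\wedge_{KN}k=k\wedge_{KN}h$ for all symmetric $h,k$. (ii) Riemann symmetries: for all symmetric $h,k$, the tensor $h\wedge_{KN}k$ has all algebraic symmetries of the Riemann curvature tensor. (iii) Dimension decomposition: the space of $(0,4)$-tensors on $V$ with Riemann symmetries has dimension $20=1+9+5+5$, the summands being the dimensions of the scalar part, the traceless Ricci part, and the two parts $W^+$ and $W^-$ of the Weyl part. (iv) Self-dual splitting: $\Lambda^2(\mathbb{R}^4)=\Lambda^2_+\oplus\Lambda^2_-$ with $\dim\Lambda^2_\pm=3$; Weyl tensors split as $W=W^+\oplus W^-$, where the spaces of possible $W^+$ and of possible $W^-$ each have dimension $5$; and the self-dual and anti-self-dual parts are orthogonal: $\langle W^+,W^-\rangle=0$. (v) $\operatorname{tr}_{14}(g\wedge_{KN}g)=-6g$. (vi) For every traceless symmetric $h$, $\operatorname{tr}_{14}(h\wedge_{KN}g)=-2h$. (vii) For every symmetric $h$, $\operatorname{tr}_{14}(h\wedge_{KN}g)=-2h-(\operatorname{tr}h)\,g$.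
   Context: For symmetric bilinear forms $h,k$ on $V$, the Kulkarni--Nomizu product is the $(0,4)$-tensor $$(h\wedge_{KN}k)(X,Y,Z,U)=h(X,Z)k(Y,U)-h(X,U)k(Y,Z)+h(Y,U)k(X,Z)-h(Y,Z)k(X,U).$$ A $(0,4)$-tensor $R$ has the Riemann symmetries if $R(X,Y,Z,U)=-R(Y,X,Z,U)=-R(X,Y,U,Z)$, $R(X,Y,Z,U)=R(Z,U,X,Y)$, and $R(X,Y,Z,U)+R(Y,Z,X,U)+R(Z,X,Y,U)=0$. For an orthonormal basis $\{e_i\}_{i=1}^4$ of $V$, $\operatorname{tr}_{14}(R)(Y,Z)=\sum_{i=1}^4R(e_i,Y,Z,e_i)$ and $\operatorname{tr}h=\sum_ih(e_i,e_i)$; $h$ is traceless if $\operatorname{tr}h=0$. Under the orthogonal group, the space of $(0,4)$-tensors with Riemann symmetries decomposes as the direct sum of a scalar part (multiples of $g\wedge_{KN}g$), a traceless Ricci part ($h\wedge_{KN}g$ with $h$ symmetric traceless) and a Weyl part (tensors with Riemann symmetries all of whose traces vanish; its elements are called Weyl tensors). The Hodge star $\star$ on $\Lambda^2(\mathbb{R}^4)$ satisfies $\star^2=\mathrm{id}$, and $\Lambda^2_\pm$ are its $\pm1$-eigenspaces. A Weyl tensor $W$, viewed as a symmetric endomorphism of $\Lambda^2$, splits as $W=W^+\oplus W^-$, where $W^\pm$ is the part acting on $\Lambda^2_\pm$. $\langle\cdot,\cdot\rangle$ is the inner product on tensors induced by $g$. *)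

theory Defs
  imports "HOL-Analysis.Analysis" "HOL-Library.Function_Algebras"
begin

text \<open>
  Real-valued functions of several vectors form a real vector space under pointwise operations;
  this makes \<^const>\<open>subspace\<close> and \<^const>\<open>dim\<close> available for spaces of
  covariant tensors.
\<close>

instantiation "fun" :: (type, real_vector) real_vector
begin

definition scaleR_fun :: "real \<Rightarrow> ('a \<Rightarrow> 'b) \<Rightarrow> 'a \<Rightarrow> 'b"
  where "scaleR_fun c f = (\<lambda>x. c *\<^sub>R f x)"

instance
  by standard (simp_all add: scaleR_fun_def fun_eq_iff algebra_simps)

end

type_synonym 'a tensor2 = "'a \<Rightarrow> 'a \<Rightarrow> real"
type_synonym 'a tensor4 = "'a \<Rightarrow> 'a \<Rightarrow> 'a \<Rightarrow> 'a \<Rightarrow> real"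

text \<open>Internal direct sum of a finite list of subspaces.\<close>

definition internal_direct_sum :: "'v::real_vector set \<Rightarrow> 'v set list \<Rightarrow> bool"
  where "internal_direct_sum U As \<longleftrightarrow>
    subspace U \<and> (\<forall>A\<in>set As. subspace A \<and> A \<subseteq> U) \<and>
    (\<forall>x\<in>U. \<exists>!xs. list_all2 (\<in>) xs As \<and> sum_list xs = x)"

section \<open>Algebraic curvature tensors\<close>

text \<open>The metric \<open>g\<close> is the inner product of the type.\<close>

abbreviation metric :: "'a::euclidean_space tensor2" (\<open>\<g>\<close>)
  where "\<g> \<equiv> inner"

definition symmetric_form :: "'a::euclidean_space tensor2 \<Rightarrow> bool"
  where "symmetric_form h \<longleftrightarrow> bilinear h \<and> (\<forall>X Y. h X Y = h Y X)"

definition kulkarni_nomizu ::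
    "'a::euclidean_space tensor2 \<Rightarrow> 'a tensor2 \<Rightarrow> 'a tensor4" (infixl \<open>\<and>\<^sub>K\<^sub>N\<close> 70)
  where "(h \<and>\<^sub>K\<^sub>N k) = (\<lambda>X Y Z U.
    h X Z * k Y U - h X U * k Y Z + h Y U * k X Z - h Y Z * k X U)"

definition multilinear4 :: "'a::euclidean_space tensor4 \<Rightarrow> bool"
  where "multilinear4 R \<longleftrightarrow>
    (\<forall>Y Z U. linear (\<lambda>X. R X Y Z U)) \<and> (\<forall>X Z U. linear (\<lambda>Y. R X Y Z U)) \<and>
    (\<forall>X Y U. linear (\<lambda>Z. R X Y Z U)) \<and> (\<forall>X Y Z. linear (\<lambda>U. R X Y Z U))"

definition riemann_tensors :: "'a::euclidean_space tensor4 set"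
  where "riemann_tensors = {R. multilinear4 R \<and>
    (\<forall>X Y Z U. R X Y Z U = - R Y X Z U) \<and>
    (\<forall>X Y Z U. R X Y Z U = - R X Y U Z) \<and>
    (\<forall>X Y Z U. R X Y Z U = R Z U X Y) \<and>
    (\<forall>X Y Z U. R X Y Z U + R Y Z X U + R Z X Y U = 0)}"

text \<open>
  A family \<open>e\<close> indexed by the four-element type \<^typ>\<open>4\<close>. It serves both to
  take traces and to fix the orientation, namely the one for which \<open>e 1, e 2, e 3, e 4\<close>
  is positively oriented.
\<close>

definition orthonormal_frame :: "(4 \<Rightarrow> 'a::euclidean_space) \<Rightarrow> bool"
  where "orthonormal_frame e \<longleftrightarrow> (\<forall>i j. e i \<bullet> e j = (if i = j then 1 else 0))"

definition form_trace :: "(4 \<Rightarrow> 'a::euclidean_space) \<Rightarrow> 'a tensor2 \<Rightarrow> real"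
  where "form_trace e h = (\<Sum>i\<in>UNIV. h (e i) (e i))"

definition trace14 :: "(4 \<Rightarrow> 'a::euclidean_space) \<Rightarrow> 'a tensor4 \<Rightarrow> 'a tensor2"
  where "trace14 e R = (\<lambda>Y Z. \<Sum>i\<in>UNIV. R (e i) Y Z (e i))"

definition tensor_inner :: "(4 \<Rightarrow> 'a::euclidean_space) \<Rightarrow> 'a tensor4 \<Rightarrow> 'a tensor4 \<Rightarrow> real"
  where "tensor_inner e R S = (\<Sum>i\<in>UNIV. \<Sum>j\<in>UNIV. \<Sum>k\<in>UNIV. \<Sum>l\<in>UNIV.
    R (e i) (e j) (e k) (e l) * S (e i) (e j) (e k) (e l))"

definition scalar_part :: "'a::euclidean_space tensor4 set"
  where "scalar_part = {c *\<^sub>R (\<g> \<and>\<^sub>K\<^sub>N \<g>) |c. True}"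

definition traceless_ricci_part :: "(4 \<Rightarrow> 'a::euclidean_space) \<Rightarrow> 'a tensor4 set"
  where "traceless_ricci_part e =
    {h \<and>\<^sub>K\<^sub>N \<g> |h. symmetric_form h \<and> form_trace e h = 0}"

definition weyl_tensors :: "(4 \<Rightarrow> 'a::euclidean_space) \<Rightarrow> 'a tensor4 set"
  where "weyl_tensors e = {W \<in> riemann_tensors. \<forall>X Y.
    (\<Sum>i\<in>UNIV. W (e i) (e i) X Y) = 0 \<and> (\<Sum>i\<in>UNIV. W (e i) X (e i) Y) = 0 \<and>
    (\<Sum>i\<in>UNIV. W (e i) X Y (e i)) = 0 \<and> (\<Sum>i\<in>UNIV. W X (e i) (e i) Y) = 0 \<and>
    (\<Sum>i\<in>UNIV. W X (e i) Y (e i)) = 0 \<and> (\<Sum>i\<in>UNIV. W X Y (e i) (e i)) = 0}"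

section \<open>Two-forms, the Hodge star and self-duality\<close>

text \<open>
  \<open>\<Lambda>\<^sup>2\<close> is modelled by alternating bilinear forms, vectors being identified
  with covectors by means of the metric; \<open>wedge Z U\<close> is the simple element
  \<open>Z \<and> U\<close>.
\<close>

definition two_forms :: "'a::euclidean_space tensor2 set"
  where "two_forms = {\<omega>. bilinear \<omega> \<and> (\<forall>X. \<omega> X X = 0)}"

definition wedge :: "'a::euclidean_space \<Rightarrow> 'a \<Rightarrow> 'a tensor2"
  where "wedge Z U = (\<lambda>X Y. (Z \<bullet> X) * (U \<bullet> Y) - (Z \<bullet> Y) * (U \<bullet> X))"

definition volume_form :: "(4 \<Rightarrow> 'a::euclidean_space) \<Rightarrow> 'a tensor4"
  where "volume_form e X Y Z U =
    det (vector [\<chi> j. X \<bullet> e j, \<chi> j. Y \<bullet> e j, \<chi> j. Z \<bullet> e j, \<chi> j. U \<bullet> e j] :: real^4^4)"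

text \<open>
  In an oriented orthonormal frame,
  \<open>(\<star>\<omega>)\<^sub>i\<^sub>j = 1/2 \<Sum>\<^sub>k\<^sub>l \<epsilon>\<^sub>i\<^sub>j\<^sub>k\<^sub>l \<omega>\<^sub>k\<^sub>l\<close>.
\<close>

definition hodge_star :: "(4 \<Rightarrow> 'a::euclidean_space) \<Rightarrow> 'a tensor2 \<Rightarrow> 'a tensor2"
  where "hodge_star e \<omega> = (\<lambda>X Y.
    (\<Sum>k\<in>UNIV. \<Sum>l\<in>UNIV. volume_form e X Y (e k) (e l) * \<omega> (e k) (e l)) / 2)"

text \<open>
  In what follows the sign \<open>s\<close> is \<open>1\<close> for the self-dual and \<open>-1\<close> for the
  anti-self-dual case. Since the Hodge star is an involution on two-forms,
  \<open>dual_projection e s\<close> is the projection onto its \<open>s\<close>-eigenspace.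
\<close>

definition dual_forms :: "(4 \<Rightarrow> 'a::euclidean_space) \<Rightarrow> real \<Rightarrow> 'a tensor2 set"
  where "dual_forms e s = {\<omega> \<in> two_forms. hodge_star e \<omega> = s *\<^sub>R \<omega>}"

definition dual_projection :: "(4 \<Rightarrow> 'a::euclidean_space) \<Rightarrow> real \<Rightarrow> 'a tensor2 \<Rightarrow> 'a tensor2"
  where "dual_projection e s \<omega> = (1/2) *\<^sub>R (\<omega> + s *\<^sub>R hodge_star e \<omega>)"

text \<open>
  The endomorphism of \<open>\<Lambda>\<^sup>2\<close> given by a curvature tensor; the factor \<open>1/2\<close> is
  such that \<open>(curvature_operator e R (wedge Z U)) X Y = R X Y Z U\<close>.
\<close>

definition curvature_operator :: "(4 \<Rightarrow> 'a::euclidean_space) \<Rightarrow> 'a tensor4 \<Rightarrow> 'a tensor2 \<Rightarrow> 'a tensor2"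
  where "curvature_operator e R \<omega> = (\<lambda>X Y.
    (\<Sum>k\<in>UNIV. \<Sum>l\<in>UNIV. R X Y (e k) (e l) * \<omega> (e k) (e l)) / 2)"

text \<open>
  The diagonal block of the endomorphism \<open>W\<close> on the \<open>s\<close>-eigenspace of the Hodge star,
  extended by zero to the other eigenspace and read again as a \<open>(0,4)\<close>-tensor.
\<close>

definition dual_part :: "(4 \<Rightarrow> 'a::euclidean_space) \<Rightarrow> real \<Rightarrow> 'a tensor4 \<Rightarrow> 'a tensor4"
  where "dual_part e s W = (\<lambda>X Y Z U.
    dual_projection e s (curvature_operator e W (dual_projection e s (wedge Z U))) X Y)"

definition weyl_dual_tensors :: "(4 \<Rightarrow> 'a::euclidean_space) \<Rightarrow> real \<Rightarrow> 'a tensor4 set"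
  where "weyl_dual_tensors e s = dual_part e s ` weyl_tensors e"

end

(*
  In an orthonormal frame Lambda^2_s (s = 1, -1) has the orthogonal basis
  e12 + s e34, e13 - s e24, e14 + s e23. Expanding a curvature tensor R in the products of these
  two-forms gives four 3x3 blocks. The two mixed blocks are transposes of each other and carry the
  traceless Ricci tensor, so they vanish for a Weyl tensor. The two diagonal blocks of a Weyl
  tensor are symmetric, and tr14 = 0 and the Bianchi identity make both traceless; conversely
  every symmetric traceless 3x3 matrix arises, whence the dimensions 5 and 5. The remaining
  parts are read off from the trace formula (vii), whose right-hand side is injective in h.
*)
theory Submission
  imports Defs
begin

section \<open>Linear algebra\<close>

text \<open>Tensors are functions on the whole space, so their ambient vector space is not Euclidean
  and a finite dimension has to be exhibited. Every space in question is therefore presented as the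
  range of an injective linear map from a coordinate space: \<open>real^3\<close> for an eigenspace
  of the star, and tuples of 1, 9 and 5 reals for the parts of curvature, where 9 = 10 - 1 and 5 = 6
  - 1 count symmetric matrices of size 4 and 3 without trace. The total 20 comes from one such map
  on the product of the parameter spaces.

  The minus sign in e13 - s e24 is there because the star sends e13 to -e24; since
  \<open>s * s = 1\<close>, both dualities share one computation.

  Neither trace condition suffices alone for the diagonal blocks. The wedge square of each basis
  form is 2s times the volume form, so the Bianchi identity says that the two block traces agree,
  while tr14 = 0 makes their sum vanish.\<close>

lemma det_4:
  "det (A :: 'a::comm_ring_1^4^4) =
    (A$1$1 * A$2$2 - A$1$2 * A$2$1) * (A$3$3 * A$4$4 - A$3$4 * A$4$3)
  - (A$1$1 * A$2$3 - A$1$3 * A$2$1) * (A$3$2 * A$4$4 - A$3$4 * A$4$2)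
  + (A$1$1 * A$2$4 - A$1$4 * A$2$1) * (A$3$2 * A$4$3 - A$3$3 * A$4$2)
  + (A$1$2 * A$2$3 - A$1$3 * A$2$2) * (A$3$1 * A$4$4 - A$3$4 * A$4$1)
  - (A$1$2 * A$2$4 - A$1$4 * A$2$2) * (A$3$1 * A$4$3 - A$3$3 * A$4$1)
  + (A$1$3 * A$2$4 - A$1$4 * A$2$3) * (A$3$1 * A$4$2 - A$3$2 * A$4$1)"
proof -
  have f1: "finite {4::4}" "(3::4) \<notin> {4}" by auto
  have f2: "finite {3, 4::4}" "(2::4) \<notin> {3, 4}" by auto
  have f3: "finite {2, 3, 4::4}" "(1::4) \<notin> {2, 3, 4}" by auto
  show ?thesis
    unfolding det_def UNIV_4
    unfolding sum_over_permutations_insert[OF f3]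
    unfolding sum_over_permutations_insert[OF f2]
    unfolding sum_over_permutations_insert[OF f1]
    unfolding permutes_sing
    by (simp add: sign_swap_id permutation_swap_id sign_compose sign_id permutation_compose
        algebra_simps)
qed

lemma vector_4:
  "(vector [x, y, z, w] :: ('a::zero)^4) $ 1 = x"
  "(vector [x, y, z, w] :: ('a::zero)^4) $ 2 = y"
  "(vector [x, y, z, w] :: ('a::zero)^4) $ 3 = z"
  "(vector [x, y, z, w] :: ('a::zero)^4) $ 4 = w"
  unfolding vector_def by simp_all

text \<open>The standard basis is carried to an independent spanning set of the range. All dimension
  counts below go through this fact, with a space of tensors as codomain.\<close>

lemma dim_range_inj:
  fixes f :: "'a::euclidean_space \<Rightarrow> 'b::real_vector"
  assumes "linear f" "inj f"
  shows "dim (range f) = DIM('a)"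
proof -
  have "independent (f ` Basis)"
    using assms by (simp add: linear_independent_injective_image independent_Basis inj_on_subset)
  moreover have "span (f ` Basis) = range f"
    using linear_span_image[OF assms(1), of Basis] by simp
  ultimately have "dim (range f) = card (f ` Basis)"
    by (intro dim_eq_card) (auto simp: span_span simp flip: \<open>span _ = range f\<close>)
  then show ?thesis
    using assms(2) by (simp add: card_image inj_on_subset)
qed

text \<open>Uniqueness only has to be checked at 0: the componentwise difference of two
  decompositions of the same vector is again a list of members of the subspaces, and its sum is
  0.\<close>

lemma internal_direct_sumI:
  assumes "subspace U" "\<And>A. A \<in> set As \<Longrightarrow> subspace A \<and> A \<subseteq> U"
    and ex: "\<And>x. x \<in> U \<Longrightarrow> \<exists>xs. list_all2 (\<in>) xs As \<and> sum_list xs = x"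
    and indep: "\<And>xs. list_all2 (\<in>) xs As \<Longrightarrow> sum_list xs = 0 \<Longrightarrow> \<forall>x\<in>set xs. x = 0"
  shows "internal_direct_sum U As"
proof -
  have *: "xs = ys" if "list_all2 (\<in>) xs As" "list_all2 (\<in>) ys As" "sum_list xs = sum_list ys" for xs ys
  proof -
    have len: "length xs = length ys" using that(1,2) by (simp add: list_all2_lengthD)
    have "list_all2 (\<in>) (map2 (-) xs ys) As"
      using that(1,2) assms(2) by (auto simp: list_all2_conv_all_nth intro!: subspace_diff)
    moreover have "sum_list (map2 (-) xs ys) = 0"
      using sum_list_subtractf[of fst snd "zip xs ys"] len that(3)
      by (simp add: case_prod_beta')
    ultimately have "\<forall>x\<in>set (map2 (-) xs ys). x = 0" by (rule indep)
    then have "\<forall>p\<in>set (zip xs ys). fst p = snd p" by (simp add: case_prod_beta)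
    with len show ?thesis
      by (induction rule: list_induct2) auto
  qed
  show ?thesis unfolding internal_direct_sum_def
  proof (intro conjI ballI)
    show "\<exists>!xs. list_all2 (\<in>) xs As \<and> sum_list xs = x" if "x \<in> U" for x
      using ex[OF that] by (rule ex_ex1I) (rule *, auto)
  qed (use assms in auto)
qed

lemma internal_direct_sum2I:
  assumes "subspace U" "subspace A" "subspace B" "A \<subseteq> U" "B \<subseteq> U"
    and "\<And>x. x \<in> U \<Longrightarrow> \<exists>a\<in>A. \<exists>b\<in>B. x = a + b"
    and "\<And>a b. a \<in> A \<Longrightarrow> b \<in> B \<Longrightarrow> a + b = 0 \<Longrightarrow> a = 0 \<and> b = 0"
  shows "internal_direct_sum U [A, B]"
proof (rule internal_direct_sumI)
  show "\<exists>xs. list_all2 (\<in>) xs [A, B] \<and> sum_list xs = x" if "x \<in> U" for x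
  proof -
    from assms(6)[OF that] obtain a b where "a \<in> A" "b \<in> B" "x = a + b" by blast
    then show ?thesis by (intro exI[of _ "[a, b]"]) simp
  qed
  show "\<forall>x\<in>set xs. x = 0" if "list_all2 (\<in>) xs [A, B]" "sum_list xs = 0" for xs
  proof -
    from that(1) obtain a b where "xs = [a, b]" "a \<in> A" "b \<in> B"
      by (auto simp: list_all2_Cons2)
    with that(2) assms(7)[of a b] show ?thesis by simp
  qed
qed (use assms in auto)

lemma fun_apply_simps:
  "(f + g) x = f x + g x" "(f - g) x = f x - g x" "(- f) x = - f x" "(c *\<^sub>R f) x = c *\<^sub>R f x"
  by (simp_all add: scaleR_fun_def)

section \<open>Algebraic symmetries and traces\<close>

lemma riemann_tensorsD:
  assumes "R \<in> riemann_tensors"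
  shows "multilinear4 R" "R X Y Z U = - R Y X Z U" "R X Y Z U = - R X Y U Z" "R X Y Z U = R Z U X Y"
    "R X Y Z U + R Y Z X U + R Z X Y U = 0"
  using assms unfolding riemann_tensors_def by blast+

lemma subspace_riemann_tensors: "subspace (riemann_tensors :: 'a::euclidean_space tensor4 set)"
proof -
  have "0 \<in> riemann_tensors"
    by (simp add: riemann_tensors_def multilinear4_def linear_iff)
  moreover have "R + S \<in> riemann_tensors"
    if R: "R \<in> riemann_tensors" and S: "S \<in> riemann_tensors" for R S :: "'a tensor4"
  proof -
    have "multilinear4 (R + S)"
      using riemann_tensorsD(1)[OF R] riemann_tensorsD(1)[OF S]
      by (auto simp: multilinear4_def fun_apply_simps intro!: linear_compose_add)
    moreover have "R X Y Z U + S X Y Z U = - (R Y X Z U + S Y X Z U)" for X Y Z U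
      using riemann_tensorsD(2)[OF R, of X Y Z U] riemann_tensorsD(2)[OF S, of X Y Z U] by simp
    moreover have "R X Y Z U + S X Y Z U = - (R X Y U Z + S X Y U Z)" for X Y Z U
      using riemann_tensorsD(3)[OF R, of X Y Z U] riemann_tensorsD(3)[OF S, of X Y Z U] by simp
    moreover have "R X Y Z U + S X Y Z U = R Z U X Y + S Z U X Y" for X Y Z U
      using riemann_tensorsD(4)[OF R, of X Y Z U] riemann_tensorsD(4)[OF S, of X Y Z U] by simp
    moreover have "R X Y Z U + S X Y Z U + (R Y Z X U + S Y Z X U) + (R Z X Y U + S Z X Y U) = 0" for X Y Z U
      using riemann_tensorsD(5)[OF R, of X Y Z U] riemann_tensorsD(5)[OF S, of X Y Z U] by simp
    ultimately show ?thesis unfolding riemann_tensors_def mem_Collect_eq fun_apply_simps by blast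
  qed
  moreover have "c *\<^sub>R R \<in> riemann_tensors" if R: "R \<in> riemann_tensors" for c and R :: "'a tensor4"
  proof -
    have "multilinear4 (c *\<^sub>R R)"
      using riemann_tensorsD(1)[OF R]
      by (auto simp: multilinear4_def fun_apply_simps linear_iff algebra_simps)
    moreover have "c * R X Y Z U = - (c * R Y X Z U)" for X Y Z U
      using riemann_tensorsD(2)[OF R, of X Y Z U] by simp
    moreover have "c * R X Y Z U = - (c * R X Y U Z)" for X Y Z U
      using riemann_tensorsD(3)[OF R, of X Y Z U] by simp
    moreover have "c * R X Y Z U = c * R Z U X Y" for X Y Z U
      using riemann_tensorsD(4)[OF R, of X Y Z U] by simp
    moreover have "c * R X Y Z U + c * R Y Z X U + c * R Z X Y U = 0" for X Y Z U
      using riemann_tensorsD(5)[OF R, of X Y Z U] by (simp flip: distrib_left)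
    ultimately show ?thesis
      unfolding riemann_tensors_def mem_Collect_eq fun_apply_simps real_scaleR_def by blast
  qed
  ultimately show ?thesis by (rule subspaceI)
qed

definition sym_traceless :: "(3 \<Rightarrow> 3 \<Rightarrow> real) set"
  where "sym_traceless = {A. (\<forall>a b. A a b = A b a) \<and> (\<Sum>a\<in>UNIV. A a a) = 0}"

lemma symmetric_form_inner: "symmetric_form (inner :: 'a::euclidean_space tensor2)"
  by (simp add: symmetric_form_def bilinear_def linear_iff inner_add_left inner_add_right inner_commute)

lemma kulkarni_nomizu_commute: "h \<and>\<^sub>K\<^sub>N k = k \<and>\<^sub>K\<^sub>N h"
  by (intro ext) (simp add: kulkarni_nomizu_def algebra_simps)

lemma kulkarni_nomizu_riemann:
  assumes "symmetric_form h" "symmetric_form k"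
  shows "h \<and>\<^sub>K\<^sub>N k \<in> riemann_tensors"
proof -
  have b: "bilinear h" "bilinear k" and sh: "h X Y = h Y X" and sk: "k X Y = k Y X" for X Y
    using assms unfolding symmetric_form_def by blast+
  note lin = bilinear_ladd[OF b(1)] bilinear_ladd[OF b(2)] bilinear_radd[OF b(1)] bilinear_radd[OF b(2)]
    bilinear_lmul[OF b(1)] bilinear_lmul[OF b(2)] bilinear_rmul[OF b(1)] bilinear_rmul[OF b(2)]
  have "multilinear4 (h \<and>\<^sub>K\<^sub>N k)"
    by (simp add: multilinear4_def linear_iff kulkarni_nomizu_def lin algebra_simps)
  moreover have "(h \<and>\<^sub>K\<^sub>N k) X Y Z U = - (h \<and>\<^sub>K\<^sub>N k) Y X Z U" for X Y Z U
    by (simp add: kulkarni_nomizu_def)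
  moreover have "(h \<and>\<^sub>K\<^sub>N k) X Y Z U = - (h \<and>\<^sub>K\<^sub>N k) X Y U Z" for X Y Z U
    by (simp add: kulkarni_nomizu_def)
  moreover have "(h \<and>\<^sub>K\<^sub>N k) X Y Z U = (h \<and>\<^sub>K\<^sub>N k) Z U X Y" for X Y Z U
    by (simp add: kulkarni_nomizu_def sh[of Z] sh[of U] sk[of Z] sk[of U])
  moreover have "(h \<and>\<^sub>K\<^sub>N k) X Y Z U + (h \<and>\<^sub>K\<^sub>N k) Y Z X U + (h \<and>\<^sub>K\<^sub>N k) Z X Y U = 0" for X Y Z U
    by (simp add: kulkarni_nomizu_def sh[of Y X] sh[of Z X] sh[of Z Y] sk[of Y X] sk[of Z X] sk[of Z Y])
  ultimately show ?thesis unfolding riemann_tensors_def by blast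
qed

lemma kulkarni_nomizu_add: "(h + h') \<and>\<^sub>K\<^sub>N k = h \<and>\<^sub>K\<^sub>N k + h' \<and>\<^sub>K\<^sub>N k"
  by (intro ext) (simp add: kulkarni_nomizu_def fun_apply_simps algebra_simps)

lemma kulkarni_nomizu_scale: "(c *\<^sub>R h) \<and>\<^sub>K\<^sub>N k = c *\<^sub>R (h \<and>\<^sub>K\<^sub>N k)"
  by (intro ext) (simp add: kulkarni_nomizu_def fun_apply_simps algebra_simps)

lemma trace14_add: "trace14 e (R + S) = trace14 e R + trace14 e S"
  by (intro ext) (simp add: trace14_def fun_apply_simps sum.distrib)

lemma trace14_scale: "trace14 e (c *\<^sub>R R) = c *\<^sub>R trace14 e R"
  by (intro ext) (simp add: trace14_def fun_apply_simps sum_distrib_left)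

lemma form_trace_add: "form_trace e (h + k) = form_trace e h + form_trace e k"
  by (simp add: form_trace_def fun_apply_simps sum.distrib)

lemma form_trace_scale: "form_trace e (c *\<^sub>R h) = c * form_trace e h"
  by (simp add: form_trace_def fun_apply_simps sum_distrib_left)

lemma subspace_symmetric_form: "subspace {h :: 'a::euclidean_space tensor2. symmetric_form h}"
  by (rule subspaceI) (auto simp: symmetric_form_def bilinear_def linear_iff fun_apply_simps algebra_simps)

section \<open>Coordinates on symmetric traceless 3x3 matrices\<close>

lemma sym_traceless_3_3: "A 3 3 = - A 1 1 - A 2 2" if "A \<in> sym_traceless"
  using that by (auto simp: sym_traceless_def sum_3)

text \<open>The coordinates are two diagonal entries and the three entries above the diagonal. An
  off-diagonal entry is selected by the index that is absent from the pair, which makes the matrix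
  symmetric by construction.\<close>

definition traceless3 :: "real \<times> real \<times> real \<times> real \<times> real \<Rightarrow> 3 \<Rightarrow> 3 \<Rightarrow> real"
  where "traceless3 = (\<lambda>(p, q, x, y, z) a b.
    if a = b then (if a = 1 then p else if a = 2 then q else - p - q)
    else if a \<noteq> 3 \<and> b \<noteq> 3 then x else if a \<noteq> 2 \<and> b \<noteq> 2 then y else z)"

lemma traceless3_range: "range traceless3 = sym_traceless"
proof (intro equalityI subsetI)
  fix A assume A: "A \<in> sym_traceless"
  have "A = traceless3 (A 1 1, A 2 2, A 1 2, A 1 3, A 2 3)"
  proof (intro ext)
    fix a b
    show "A a b = traceless3 (A 1 1, A 2 2, A 1 2, A 1 3, A 2 3) a b"
      using A exhaust_3[of a] exhaust_3[of b] sym_traceless_3_3[OF A]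
      by (elim disjE) (simp_all add: traceless3_def sym_traceless_def)
  qed
  then show "A \<in> range traceless3" by blast
qed (auto simp: traceless3_def sym_traceless_def sum_3)

lemma linear_traceless3: "linear traceless3"
  by (intro linearI ext) (auto simp: traceless3_def fun_apply_simps algebra_simps)

lemma inj_traceless3: "inj traceless3"
proof (rule injI)
  fix v w assume "traceless3 v = traceless3 w"
  then have "traceless3 v a b = traceless3 w a b" for a b by simp
  from this[of 1 1] this[of 2 2] this[of 1 2] this[of 1 3] this[of 2 3] show "v = w"
    by (simp add: traceless3_def split: prod.splits)
qed

section \<open>Two-forms in an orthonormal frame\<close>

locale oriented_frame =
  fixes e :: "4 \<Rightarrow> 'a::euclidean_space"
  assumes dim4: "DIM('a) = 4" and orthonormal: "orthonormal_frame e"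
begin

lemma inner_frame: "e i \<bullet> e j = (if i = j then 1 else 0)"
  using orthonormal by (simp add: orthonormal_frame_def)

text \<open>Four orthonormal vectors are independent and hence span a space of dimension 4. The
  difference of the two sides is orthogonal to the frame, so to every vector, including
  itself.\<close>

lemma frame_expansion: "X = (\<Sum>i\<in>UNIV. (X \<bullet> e i) *\<^sub>R e i)"
proof -
  have inj: "inj e"
    by (rule injI) (metis inner_frame zero_neq_one)
  have "pairwise orthogonal (range e)" "0 \<notin> range e"
    using inner_frame by (auto simp: pairwise_def orthogonal_def) (metis inner_zero_left zero_neq_one)
  then have "independent (range e)"
    by (rule pairwise_orthogonal_independent)
  then have sp: "span (range e) = UNIV"
    using card_ge_dim_independent[of "range e" UNIV] inj by (auto simp: card_image dim4)
  have *: "orthogonal (X - (\<Sum>i\<in>UNIV. (X \<bullet> e i) *\<^sub>R e i)) y" if "y \<in> range e" for y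
    using that by (auto simp: orthogonal_def inner_diff_left inner_sum_left inner_frame if_distrib cong: if_cong)
  have "orthogonal (X - (\<Sum>i\<in>UNIV. (X \<bullet> e i) *\<^sub>R e i)) y" for y
    by (rule orthogonal_to_span[of _ "range e"]) (simp_all add: sp *)
  then show ?thesis using orthogonal_self[of "X - (\<Sum>i\<in>UNIV. (X \<bullet> e i) *\<^sub>R e i)"] by simp
qed

lemma form_expansion:
  assumes "bilinear h"
  shows "h X Y = (\<Sum>i\<in>UNIV. \<Sum>j\<in>UNIV. (X \<bullet> e i) * (Y \<bullet> e j) * h (e i) (e j))"
proof -
  interpret l: linear "\<lambda>x. h x y" for y using assms by (simp add: bilinear_def)
  interpret r: linear "\<lambda>y. h x y" for x using assms by (simp add: bilinear_def)
  have "h X Y = h (\<Sum>i\<in>UNIV. (X \<bullet> e i) *\<^sub>R e i) (\<Sum>j\<in>UNIV. (Y \<bullet> e j) *\<^sub>R e j)"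
    using frame_expansion by metis
  also have "\<dots> = (\<Sum>i\<in>UNIV. \<Sum>j\<in>UNIV. (X \<bullet> e i) * (Y \<bullet> e j) * h (e i) (e j))"
    by (simp add: sum_4 l.add l.scale r.add r.scale algebra_simps)
  finally show ?thesis .
qed

text \<open>Polarisation of \<open>\<omega> (X + Y) (X + Y) = 0\<close>.\<close>

lemma two_forms_alt: "\<omega> \<in> two_forms \<Longrightarrow> \<omega> X Y = - \<omega> Y X" for \<omega> :: "'a tensor2"
proof -
  assume "\<omega> \<in> two_forms"
  then have "bilinear \<omega>" "\<And>X. \<omega> X X = 0" by (auto simp: two_forms_def)
  moreover have "\<omega> (X + Y) (X + Y) = 0" by fact
  ultimately show ?thesis
    using bilinear_ladd[of \<omega> X Y "X + Y"] bilinear_radd[of \<omega> X X Y] bilinear_radd[of \<omega> Y X Y] by simp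
qed

lemma bilinear_wedge: "bilinear (wedge Z U)" for Z U :: 'a
  by (auto simp: bilinear_def wedge_def inner_right_distrib algebra_simps intro!: linearI)

lemma wedge_two_form: "wedge Z U \<in> two_forms" for Z U :: 'a
  by (simp add: two_forms_def bilinear_wedge) (simp add: wedge_def)

lemma wedge_frame:
  "wedge (e i) (e j) (e k) (e l) =
    (if i = k then 1 else 0) * (if j = l then 1 else 0) -
    (if i = l then 1 else 0) * (if j = k then 1 else 0)"
  by (simp add: wedge_def inner_frame)

lemma two_form_expansion:
  assumes "\<omega> \<in> two_forms"
  shows "\<omega> X Y =
    \<omega> (e 1) (e 2) * wedge (e 1) (e 2) X Y + \<omega> (e 1) (e 3) * wedge (e 1) (e 3) X Y +
    \<omega> (e 1) (e 4) * wedge (e 1) (e 4) X Y + \<omega> (e 2) (e 3) * wedge (e 2) (e 3) X Y +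
    \<omega> (e 2) (e 4) * wedge (e 2) (e 4) X Y + \<omega> (e 3) (e 4) * wedge (e 3) (e 4) X Y"
proof -
  have "bilinear \<omega>" and d: "\<And>X. \<omega> X X = 0" using assms by (auto simp: two_forms_def)
  note a = two_forms_alt[OF assms]
  show ?thesis
    by (subst form_expansion[OF \<open>bilinear \<omega>\<close>], simp only: sum_4 d
        a[of "e 2" "e 1"] a[of "e 3" "e 1"] a[of "e 4" "e 1"]
        a[of "e 3" "e 2"] a[of "e 4" "e 2"] a[of "e 4" "e 3"])
      (simp add: wedge_def inner_commute algebra_simps)
qed

text \<open>\<open>det_4\<close> is the Laplace expansion along the first two rows. Each 2x2 minor
  is the value of a wedge of two frame vectors, so the volume form pairs every coordinate plane with
  its complement, with the sign of the permutation.\<close>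

lemma volume_form_wedge:
  "volume_form e X Y Z U =
    wedge (e 1) (e 2) X Y * wedge (e 3) (e 4) Z U - wedge (e 1) (e 3) X Y * wedge (e 2) (e 4) Z U +
    wedge (e 1) (e 4) X Y * wedge (e 2) (e 3) Z U + wedge (e 2) (e 3) X Y * wedge (e 1) (e 4) Z U -
    wedge (e 2) (e 4) X Y * wedge (e 1) (e 3) Z U + wedge (e 3) (e 4) X Y * wedge (e 1) (e 2) Z U"
  by (simp add: volume_form_def det_4 vector_4 wedge_def inner_commute algebra_simps)

text \<open>The double sum meets every coordinate plane twice, which cancels the factor 1/2; what is
  left exchanges complementary planes with the signs of \<open>volume_form_wedge\<close>.\<close>

lemma hodge_star_two_form:
  assumes "\<omega> \<in> two_forms"
  shows "hodge_star e \<omega> X Y =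
    \<omega> (e 3) (e 4) * wedge (e 1) (e 2) X Y - \<omega> (e 2) (e 4) * wedge (e 1) (e 3) X Y +
    \<omega> (e 2) (e 3) * wedge (e 1) (e 4) X Y + \<omega> (e 1) (e 4) * wedge (e 2) (e 3) X Y -
    \<omega> (e 1) (e 3) * wedge (e 2) (e 4) X Y + \<omega> (e 1) (e 2) * wedge (e 3) (e 4) X Y"
proof -
  have d: "\<And>X. \<omega> X X = 0" using assms by (auto simp: two_forms_def)
  note a = two_forms_alt[OF assms]
  show ?thesis
    by (simp add: hodge_star_def sum_4 volume_form_wedge wedge_frame d
        a[of "e 2" "e 1"] a[of "e 3" "e 1"] a[of "e 4" "e 1"]
        a[of "e 3" "e 2"] a[of "e 4" "e 2"] a[of "e 4" "e 3"] field_simps)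
qed

text \<open>
  Since the \<open>\<theta> s a\<close> have squared norm \<open>2\<close>, \<open>dual_coord s a\<close> is half of the inner
  product with \<open>\<theta> s a\<close>; it reads off the coefficients of the projection to the
  \<open>s\<close>-eigenspace.
\<close>

definition dual_basis :: "real \<Rightarrow> 3 \<Rightarrow> 'a tensor2" (\<open>\<theta>\<close>)
  where "\<theta> s a = (
    if a = 1 then wedge (e 1) (e 2) + s *\<^sub>R wedge (e 3) (e 4)
    else if a = 2 then wedge (e 1) (e 3) - s *\<^sub>R wedge (e 2) (e 4)
    else wedge (e 1) (e 4) + s *\<^sub>R wedge (e 2) (e 3))"

definition dual_coord :: "real \<Rightarrow> 3 \<Rightarrow> 'a tensor2 \<Rightarrow> real"
  where "dual_coord s a \<omega> = (
    if a = 1 then \<omega> (e 1) (e 2) + s * \<omega> (e 3) (e 4)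
    else if a = 2 then \<omega> (e 1) (e 3) - s * \<omega> (e 2) (e 4)
    else \<omega> (e 1) (e 4) + s * \<omega> (e 2) (e 3)) / 2"

definition dual_form :: "real \<Rightarrow> (3 \<Rightarrow> real) \<Rightarrow> 'a tensor2"
  where "dual_form s c X Y = (\<Sum>a\<in>UNIV. c a * \<theta> s a X Y)"

section \<open>Coordinates in the eigenspaces of the Hodge star\<close>

lemma dual_basis_apply:
  "\<theta> s 1 X Y = wedge (e 1) (e 2) X Y + s * wedge (e 3) (e 4) X Y"
  "\<theta> s 2 X Y = wedge (e 1) (e 3) X Y - s * wedge (e 2) (e 4) X Y"
  "\<theta> s 3 X Y = wedge (e 1) (e 4) X Y + s * wedge (e 2) (e 3) X Y"
  by (simp_all add: dual_basis_def fun_apply_simps)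

lemma dual_coord_apply:
  "dual_coord s 1 \<omega> = (\<omega> (e 1) (e 2) + s * \<omega> (e 3) (e 4)) / 2"
  "dual_coord s 2 \<omega> = (\<omega> (e 1) (e 3) - s * \<omega> (e 2) (e 4)) / 2"
  "dual_coord s 3 \<omega> = (\<omega> (e 1) (e 4) + s * \<omega> (e 2) (e 3)) / 2"
  by (simp_all add: dual_coord_def)

lemma bilinear_dual_basis: "bilinear (\<theta> s a)"
  by (auto simp: bilinear_def linear_iff dual_basis_def fun_apply_simps wedge_def inner_right_distrib algebra_simps)

lemma dual_form_two_form: "dual_form s c \<in> two_forms"
  by (auto simp: two_forms_def bilinear_def linear_iff dual_form_def sum_3 dual_basis_apply
      wedge_def inner_right_distrib algebra_simps)

text \<open>Since \<open>s * s = 1\<close>, the coefficients of the projected form on two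
  complementary planes differ only by a factor \<open>s\<close> or \<open>- s\<close>, as they do in
  \<open>\<theta> s a\<close>. Three numbers therefore determine the projection.\<close>

lemma dual_projection_two_form:
  assumes "\<omega> \<in> two_forms" "s \<in> {1, -1}"
  shows "dual_projection e s \<omega> = dual_form s (\<lambda>a. dual_coord s a \<omega>)"
proof -
  have "dual_projection e s \<omega> X Y = dual_form s (\<lambda>a. dual_coord s a \<omega>) X Y" for X Y
    unfolding dual_projection_def fun_apply_simps hodge_star_two_form[OF assms(1)]
    by (subst two_form_expansion[OF assms(1)])
       (use assms(2) in \<open>auto simp: dual_form_def sum_3 dual_basis_apply dual_coord_apply field_simps\<close>)
  then show ?thesis by (intro ext)
qed

text \<open>The two planes in each basis form together contribute the factor
  \<open>(1 + s * t) / 2\<close>, which is 1 for equal signs and 0 for opposite ones.\<close>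

lemma dual_coord_dual_form:
  assumes "s \<in> {1, -1}" "t \<in> {1, -1}"
  shows "dual_coord s a (dual_form t c) = (if s = t then c a else 0)"
  using exhaust_3[of a] assms
  by (auto simp: dual_form_def sum_3 dual_basis_apply dual_coord_apply wedge_frame)

lemma dual_form_add: "dual_form s (\<lambda>a. c a + d a) = dual_form s c + dual_form s d"
  by (intro ext) (simp add: dual_form_def fun_apply_simps algebra_simps sum.distrib)

lemma dual_form_scale: "dual_form s (\<lambda>a. r * c a) = r *\<^sub>R dual_form s c"
  by (intro ext) (simp add: dual_form_def fun_apply_simps algebra_simps sum_distrib_left)

lemma dual_form_inj:
  assumes "s \<in> {1, -1}" "dual_form s c = dual_form s d"
  shows "c = d"
proof
  fix a show "c a = d a" using dual_coord_dual_form[OF assms(1) assms(1), of a c]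
      dual_coord_dual_form[OF assms(1) assms(1), of a d] assms(2) by simp
qed

text \<open>As \<open>s\<close> is its own inverse, the eigenvalue equation says that
  \<open>s\<close> times the star fixes \<open>\<omega>\<close>. This trades the eigenspace for the
  fixed points of the projection, which are computable in coordinates.\<close>

lemma hodge_star_dual_projection:
  "hodge_star e \<omega> = s *\<^sub>R \<omega> \<longleftrightarrow> dual_projection e s \<omega> = \<omega>" if "s \<in> {1, -1}" for \<omega>
proof -
  have "hodge_star e \<omega> X Y = s * \<omega> X Y \<longleftrightarrow> dual_projection e s \<omega> X Y = \<omega> X Y" for X Y
    using that by (auto simp: dual_projection_def fun_apply_simps)
  then show ?thesis by (simp add: fun_eq_iff fun_apply_simps)
qed

lemma dual_forms_eq: "dual_forms e s = range (dual_form s)" if s: "s \<in> {1, -1}"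
proof (intro equalityI subsetI)
  fix \<omega> assume "\<omega> \<in> dual_forms e s"
  then have "\<omega> \<in> two_forms" "dual_projection e s \<omega> = \<omega>"
    using hodge_star_dual_projection[OF s] by (auto simp: dual_forms_def)
  then show "\<omega> \<in> range (dual_form s)"
    using dual_projection_two_form[OF _ s] by (metis rangeI)
next
  fix \<omega> assume "\<omega> \<in> range (dual_form s)"
  then obtain c where c: "\<omega> = dual_form s c" by blast
  then have "dual_projection e s \<omega> = \<omega>"
    by (simp add: dual_projection_two_form[OF dual_form_two_form s] dual_coord_dual_form[OF s s])
  then show "\<omega> \<in> dual_forms e s"
    using dual_form_two_form hodge_star_dual_projection[OF s] by (auto simp: dual_forms_def c)
qed

lemma subspace_two_forms: "subspace (two_forms :: 'a tensor2 set)"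
  by (rule subspaceI) (auto simp: two_forms_def bilinear_def linear_iff fun_apply_simps algebra_simps)

lemma subspace_dual_forms: "subspace (dual_forms e s)" if s: "s \<in> {1, -1}"
  unfolding dual_forms_eq[OF s]
proof (rule subspaceI)
  show "0 \<in> range (dual_form s)"
    by (rule image_eqI[of _ _ "\<lambda>_. 0"]) (auto simp: dual_form_def fun_eq_iff)
next
  fix x y :: "'a tensor2" and r :: real
  assume "x \<in> range (dual_form s)"
  then obtain c where c: "x = dual_form s c" by blast
  show "r *\<^sub>R x \<in> range (dual_form s)"
    unfolding c dual_form_scale[symmetric] by (rule rangeI)
  assume "y \<in> range (dual_form s)"
  then obtain d where d: "y = dual_form s d" by blast
  show "x + y \<in> range (dual_form s)"
    unfolding c d dual_form_add[symmetric] by (rule rangeI)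
qed

lemma two_forms_direct_sum:
  "internal_direct_sum (two_forms :: 'a tensor2 set) [dual_forms e 1, dual_forms e (-1)]"
proof (rule internal_direct_sum2I)
  fix \<omega> :: "'a tensor2" assume *: "\<omega> \<in> two_forms"
  have "dual_projection e 1 \<omega> \<in> dual_forms e 1" "dual_projection e (-1) \<omega> \<in> dual_forms e (-1)"
    by (simp_all add: dual_forms_eq dual_projection_two_form[OF *])
  moreover have "\<omega> = dual_projection e 1 \<omega> + dual_projection e (-1) \<omega>"
    by (auto simp: dual_projection_def fun_eq_iff fun_apply_simps field_simps)
  ultimately show "\<exists>a\<in>dual_forms e 1. \<exists>b\<in>dual_forms e (-1). \<omega> = a + b" by blast
next
  fix a b assume "a \<in> dual_forms e 1" "b \<in> dual_forms e (-1)" "a + b = 0"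
  then have h: "hodge_star e a = a" "hodge_star e b = - b" "b = - a"
    by (auto simp: dual_forms_def eq_neg_iff_add_eq_0 add.commute fun_eq_iff fun_apply_simps)
  \<comment> \<open>By linearity of the star, \<open>a\<close> equals both \<open>b\<close> and
    \<open>- b\<close>.\<close>
  then have "hodge_star e a = - hodge_star e b"
    by (simp add: fun_eq_iff hodge_star_def sum_negf)
  with h have "a = b" by simp
  with h(3) show "a = 0 \<and> b = 0" by (simp add: fun_eq_iff)
qed (simp_all add: subspace_two_forms subspace_dual_forms, auto simp: dual_forms_def)

lemma dim_dual_forms: "dim (dual_forms e s) = 3" if s: "s \<in> {1, -1}"
proof -
  define f where "f v = dual_form s (($) v)" for v :: "real^3"
  have "linear f"
    by (intro linearI ext) (simp_all add: f_def dual_form_def fun_apply_simps sum_3 algebra_simps)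
  moreover have "inj f"
    using dual_form_inj[OF s] by (intro injI) (simp add: f_def vec_eq_iff fun_eq_iff)
  moreover have "range f = dual_forms e s"
  proof -
    have "dual_form s c = f (\<chi> a. c a)" for c by (intro ext) (simp add: f_def dual_form_def)
    then have "range (dual_form s) \<subseteq> range f" by blast
    moreover have "range f \<subseteq> range (dual_form s)" by (auto simp: f_def)
    ultimately show ?thesis unfolding dual_forms_eq[OF s] by blast
  qed
  ultimately show ?thesis using dim_range_inj[of f] by simp
qed

section \<open>Weyl tensors\<close>

lemma riemann_two_forms:
  assumes "R \<in> riemann_tensors"
  shows "R X Y \<in> two_forms" "(\<lambda>X Y. R X Y Z U) \<in> two_forms"
  using riemann_tensorsD(1)[OF assms] riemann_tensorsD(2)[OF assms, of X X for X]
    riemann_tensorsD(3)[OF assms, of _ _ X X for X]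
  by (auto simp: two_forms_def bilinear_def multilinear4_def)

text \<open>Rewriting to normal form: indices increase within each pair, the pairs are in
  lexicographic order, and the Bianchi identity removes one of the 21 remaining components.\<close>

lemma riemann_frame:
  assumes "R \<in> riemann_tensors"
  shows
    "R X X Z U = 0" "R X Y Z Z = 0"
    "R (e 2) (e 1) Z U = - R (e 1) (e 2) Z U" "R (e 3) (e 1) Z U = - R (e 1) (e 3) Z U"
    "R (e 4) (e 1) Z U = - R (e 1) (e 4) Z U" "R (e 3) (e 2) Z U = - R (e 2) (e 3) Z U"
    "R (e 4) (e 2) Z U = - R (e 2) (e 4) Z U" "R (e 4) (e 3) Z U = - R (e 3) (e 4) Z U"
    "R X Y (e 2) (e 1) = - R X Y (e 1) (e 2)" "R X Y (e 3) (e 1) = - R X Y (e 1) (e 3)"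
    "R X Y (e 4) (e 1) = - R X Y (e 1) (e 4)" "R X Y (e 3) (e 2) = - R X Y (e 2) (e 3)"
    "R X Y (e 4) (e 2) = - R X Y (e 2) (e 4)" "R X Y (e 4) (e 3) = - R X Y (e 3) (e 4)"
    "R (e 1) (e 3) (e 1) (e 2) = R (e 1) (e 2) (e 1) (e 3)"
    "R (e 1) (e 4) (e 1) (e 2) = R (e 1) (e 2) (e 1) (e 4)"
    "R (e 2) (e 3) (e 1) (e 2) = R (e 1) (e 2) (e 2) (e 3)"
    "R (e 2) (e 4) (e 1) (e 2) = R (e 1) (e 2) (e 2) (e 4)"
    "R (e 3) (e 4) (e 1) (e 2) = R (e 1) (e 2) (e 3) (e 4)"
    "R (e 1) (e 4) (e 1) (e 3) = R (e 1) (e 3) (e 1) (e 4)"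
    "R (e 2) (e 3) (e 1) (e 3) = R (e 1) (e 3) (e 2) (e 3)"
    "R (e 2) (e 4) (e 1) (e 3) = R (e 1) (e 3) (e 2) (e 4)"
    "R (e 3) (e 4) (e 1) (e 3) = R (e 1) (e 3) (e 3) (e 4)"
    "R (e 2) (e 3) (e 1) (e 4) = R (e 1) (e 4) (e 2) (e 3)"
    "R (e 2) (e 4) (e 1) (e 4) = R (e 1) (e 4) (e 2) (e 4)"
    "R (e 3) (e 4) (e 1) (e 4) = R (e 1) (e 4) (e 3) (e 4)"
    "R (e 2) (e 4) (e 2) (e 3) = R (e 2) (e 3) (e 2) (e 4)"
    "R (e 3) (e 4) (e 2) (e 3) = R (e 2) (e 3) (e 3) (e 4)"
    "R (e 3) (e 4) (e 2) (e 4) = R (e 2) (e 4) (e 3) (e 4)"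
    "R (e 1) (e 4) (e 2) (e 3) = R (e 1) (e 3) (e 2) (e 4) - R (e 1) (e 2) (e 3) (e 4)"
proof -
  have "R (e 2) (e 3) (e 1) (e 4) = R (e 1) (e 4) (e 2) (e 3)" by (rule riemann_tensorsD(4)[OF assms])
  moreover have "R (e 3) (e 1) (e 2) (e 4) = - R (e 1) (e 3) (e 2) (e 4)" by (rule riemann_tensorsD(2)[OF assms])
  ultimately show "R (e 1) (e 4) (e 2) (e 3) = R (e 1) (e 3) (e 2) (e 4) - R (e 1) (e 2) (e 3) (e 4)"
    using riemann_tensorsD(5)[OF assms, of "e 1" "e 2" "e 3" "e 4"] by linarith
  show "R X X Z U = 0" using riemann_tensorsD(2)[OF assms, of X X Z U] by simp
  show "R X Y Z Z = 0" using riemann_tensorsD(3)[OF assms, of X Y Z Z] by simp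
qed (rule riemann_tensorsD[OF assms])+

text \<open>For symmetric traceless \<open>A\<close> this is the general element of the part of sign
  \<open>s\<close>. Its endomorphism has matrix \<open>2 * A\<close> in the basis
  \<open>\<theta> s\<close>, the 2 being the squared norm of the basis forms.\<close>

definition weyl_of :: "real \<Rightarrow> (3 \<Rightarrow> 3 \<Rightarrow> real) \<Rightarrow> 'a tensor4"
  where "weyl_of s A X Y Z U = (\<Sum>a\<in>UNIV. \<Sum>b\<in>UNIV. A a b * \<theta> s a X Y * \<theta> s b Z U)"

text \<open>The coefficient of \<open>R\<close> at the product of \<open>\<theta> s a\<close> in the
  first two slots and \<open>\<theta> t b\<close> in the last two.\<close>

definition block :: "real \<Rightarrow> real \<Rightarrow> 'a tensor4 \<Rightarrow> 3 \<Rightarrow> 3 \<Rightarrow> real"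
  where "block s t R a b = dual_coord s a (\<lambda>X Y. dual_coord t b (R X Y))"

text \<open>The operator contracts the last two slots with the form, each plane counted once; the 2
  appears because \<open>dual_coord\<close> is half of the inner product with a basis form.\<close>

lemma curvature_operator_dual_form:
  assumes "R \<in> riemann_tensors"
  shows "curvature_operator e R (dual_form s c) X Y = 2 * (\<Sum>b\<in>UNIV. c b * dual_coord s b (R X Y))"
  by (simp add: curvature_operator_def dual_form_def sum_3 sum_4 dual_basis_apply dual_coord_apply
      wedge_frame riemann_frame[OF assms] field_simps)

lemma dual_coord_sum:
  "dual_coord s a (\<lambda>X Y. 2 * (\<Sum>b\<in>UNIV. c b * f b X Y)) = 2 * (\<Sum>b\<in>UNIV. c b * dual_coord s a (f b))"
  for c :: "3 \<Rightarrow> real"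
  using exhaust_3[of a] by (elim disjE) (simp_all add: dual_coord_apply sum_3 field_simps)

lemma dual_coord_wedge: "dual_coord s b (wedge Z U) = \<theta> s b Z U / 2"
  using exhaust_3[of b] by (auto simp: dual_coord_apply dual_basis_apply wedge_def inner_commute field_simps)

lemma dual_coord_two_form:
  assumes "R \<in> riemann_tensors"
  shows "(\<lambda>X Y. dual_coord s b (R X Y)) \<in> two_forms"
proof -
  have "(\<lambda>X Y. R X Y Z U) \<in> two_forms" for Z U by (rule riemann_two_forms[OF assms])
  then have "bilinear (\<lambda>X Y. R X Y Z U)" "R X X Z U = 0" for X Z U by (auto simp: two_forms_def)
  then show ?thesis using exhaust_3[of b]
    by (auto simp: two_forms_def dual_coord_apply bilinear_def linear_iff field_simps)
qed

text \<open>Needed to evaluate the outer projection in \<open>dual_part\<close> by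
  \<open>dual_projection_two_form\<close>.\<close>

lemma curvature_operator_two_form:
  assumes "R \<in> riemann_tensors"
  shows "curvature_operator e R (dual_form s c) \<in> two_forms"
proof -
  have "curvature_operator e R (dual_form s c) =
     (\<Sum>b\<in>UNIV. (2 * c b) *\<^sub>R (\<lambda>X Y. dual_coord s b (R X Y)))"
    by (intro ext) (simp add: curvature_operator_dual_form[OF assms] sum_3 fun_apply_simps)
  also have "\<dots> \<in> two_forms"
    by (intro subspace_sum subspace_scale subspace_two_forms dual_coord_two_form[OF assms])
  finally show ?thesis .
qed

text \<open>The inner projection turns \<open>wedge Z U\<close> into a form with coefficients
  \<open>\<theta> s b Z U / 2\<close>, and the operator contributes a factor 2 that cancels the
  half. The outer projection then reads off the block.\<close>

lemma dual_part_riemann: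
  assumes R: "R \<in> riemann_tensors" and s: "s \<in> {1, -1}"
  shows "dual_part e s R = weyl_of s (block s s R)"
proof (intro ext)
  fix X Y Z U
  have "dual_part e s R X Y Z U =
      dual_form s (\<lambda>a. dual_coord s a (curvature_operator e R (dual_form s (\<lambda>b. \<theta> s b Z U / 2)))) X Y"
    unfolding dual_part_def
    by (simp only: dual_projection_two_form[OF _ s] wedge_two_form dual_coord_wedge curvature_operator_two_form[OF R])
  also have "\<dots> = weyl_of s (block s s R) X Y Z U"
    unfolding dual_form_def[of s "\<lambda>a. dual_coord s a _"] weyl_of_def block_def
      curvature_operator_dual_form[OF R, abs_def] dual_coord_sum
    by (simp add: dual_form_def sum_3 algebra_simps)
  finally show "dual_part e s R X Y Z U = weyl_of s (block s s R) X Y Z U" .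
qed

text \<open>Of the six traces, two vanish by antisymmetry within a pair, and the symmetries turn the
  other four into tr14 up to sign and the order of the arguments.\<close>

lemma weyl_tensors_iff:
  assumes R: "R \<in> riemann_tensors"
  shows "R \<in> weyl_tensors e \<longleftrightarrow> trace14 e R = 0"
proof
  assume *: "trace14 e R = 0"
  then have t: "(\<Sum>i\<in>UNIV. R (e i) X Y (e i)) = 0" for X Y by (simp add: trace14_def fun_eq_iff)
  have "(\<Sum>i\<in>UNIV. R (e i) X (e i) Y) = - (\<Sum>i\<in>UNIV. R (e i) X Y (e i))" for X Y
    unfolding sum_negf[symmetric] by (intro sum.cong refl riemann_tensorsD[OF R])
  moreover have "(\<Sum>i\<in>UNIV. R X (e i) (e i) Y) = (\<Sum>i\<in>UNIV. R (e i) Y X (e i))" for X Y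
    by (intro sum.cong refl riemann_tensorsD[OF R])
  moreover have "(\<Sum>i\<in>UNIV. R X (e i) Y (e i)) = - (\<Sum>i\<in>UNIV. R (e i) X Y (e i))" for X Y
    unfolding sum_negf[symmetric] by (intro sum.cong refl riemann_tensorsD[OF R])
  ultimately show "R \<in> weyl_tensors e" using R t by (simp add: weyl_tensors_def riemann_frame[OF R])
qed (auto simp: weyl_tensors_def trace14_def fun_eq_iff)

text \<open>The left side is the value of the four-form obtained by wedging \<open>wedge A B\<close>
  with \<open>wedge A D\<close>, in which \<open>A\<close> occurs twice.\<close>

lemma wedge_bianchi:
  "wedge A B X Y * wedge A D Z U + wedge A B Y Z * wedge A D X U + wedge A B Z X * wedge A D Y U
    + (wedge A D X Y * wedge A B Z U + wedge A D Y Z * wedge A B X U + wedge A D Z X * wedge A B Y U) = 0"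
  unfolding wedge_def by (simp add: algebra_simps)

text \<open>
  The Bianchi sum of a symmetrised product of two-forms is their wedge product, up to a factor,
  and the wedge product is a multiple of the inner product on each eigenspace of the Hodge star.
\<close>

lemma dual_basis_bianchi:
  "\<exists>V. \<forall>a b.
    \<theta> s a X Y * \<theta> s b Z U + \<theta> s a Y Z * \<theta> s b X U + \<theta> s a Z X * \<theta> s b Y U +
    (\<theta> s b X Y * \<theta> s a Z U + \<theta> s b Y Z * \<theta> s a X U + \<theta> s b Z X * \<theta> s a Y U) =
    (if a = b then V else 0)"
proof -
  \<comment> \<open>\<open>P f g\<close> is the wedge product of \<open>f\<close> and
    \<open>g\<close>, evaluated at the four fixed vectors.\<close>
  define P where "P f g = f X Y * g Z U + f Y Z * g X U + f Z X * g Y U +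
      (g X Y * f Z U + g Y Z * f X U + g Z X * f Y U)" for f g :: "'a tensor2"
  have P_sym: "P f g = P g f" for f g by (simp add: P_def)
  have P_add: "P (f + f') g = P f g + P f' g" "P (r *\<^sub>R f) g = r * P f g"
    "P (f - f') g = P f g - P f' g" for f f' g r
    by (simp_all add: P_def fun_apply_simps algebra_simps)
  have P_add2: "P g (f + f') = P g f + P g f'" "P g (r *\<^sub>R f) = r * P g f"
    "P g (f - f') = P g f - P g f'" for f f' g r
    using P_add by (simp_all add: P_sym[of g])
  let ?w = "\<lambda>i j. wedge (e i) (e j)"
  have w: "wedge A B = (-1) *\<^sub>R wedge B A" for A B :: 'a
    by (intro ext) (simp add: wedge_def fun_apply_simps)
  have P0: "P (wedge A B) (wedge A D) = 0" for A B D
    unfolding P_def by (rule wedge_bianchi)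
  have P1: "P (wedge A B) (wedge D A) = 0" "P (wedge B A) (wedge D A) = 0" "P (wedge B A) (wedge A D) = 0" for A B D
    by (simp_all only: w[of D A] w[of B A] P_add P_add2 P0 mult_zero_right)
  have P2: "P (?w 1 3) (?w 2 4) = - P (?w 1 2) (?w 3 4)" "P (?w 1 4) (?w 2 3) = P (?w 1 2) (?w 3 4)"
    by (simp_all add: P_def wedge_def algebra_simps)
  have P3: "P (?w 2 4) (?w 1 3) = - P (?w 1 2) (?w 3 4)" "P (?w 2 3) (?w 1 4) = P (?w 1 2) (?w 3 4)"
     "P (?w 3 4) (?w 1 2) = P (?w 1 2) (?w 3 4)"
    using P2 P_sym by metis+
  \<comment> \<open>For distinct indices any plane of one basis form shares a frame vector with any
    plane of the other. For equal indices the two mixed terms coincide, and the signs make the value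
    independent of the index.\<close>
  have "P (\<theta> s a) (\<theta> s b) = (if a = b then 2 * s * P (?w 1 2) (?w 3 4) else 0)" for a b
    using exhaust_3[of a] exhaust_3[of b]
    by (elim disjE) (simp_all add: dual_basis_def P_add P_add2 P0 P1 P2 P3)
  then show ?thesis unfolding P_def by blast
qed

text \<open>Only the Bianchi identity uses the trace. Symmetry of \<open>A\<close> symmetrises the
  Bianchi sums of the basis products, and by \<open>dual_basis_bianchi\<close> only the diagonal
  survives, with a common value; the result is a multiple of the trace of \<open>A\<close>.\<close>

lemma weyl_of_riemann:
  assumes "A \<in> sym_traceless"
  shows "weyl_of s A \<in> riemann_tensors"
proof -
  have sym: "A 2 1 = A 1 2" "A 3 1 = A 1 3" "A 3 2 = A 2 3" and tr: "A 3 3 = - A 1 1 - A 2 2"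
    using assms by (auto simp: sym_traceless_def sum_3)
  have th: "\<theta> s a X Y = - \<theta> s a Y X" for a X Y
    using exhaust_3[of a] by (auto simp: dual_basis_apply wedge_def algebra_simps)
  have lin: "\<theta> s a (X + X') Y = \<theta> s a X Y + \<theta> s a X' Y" "\<theta> s a X (Y + Y') = \<theta> s a X Y + \<theta> s a X Y'"
    "\<theta> s a (c *\<^sub>R X) Y = c * \<theta> s a X Y" "\<theta> s a X (c *\<^sub>R Y) = c * \<theta> s a X Y" for a X X' Y Y' c
    using bilinear_dual_basis[of s a] by (auto simp: bilinear_def linear_iff)
  have "multilinear4 (weyl_of s A)"
    by (auto simp: multilinear4_def linear_iff weyl_of_def lin sum_distrib_left sum.distrib algebra_simps)
  moreover have "weyl_of s A X Y Z U = - weyl_of s A Y X Z U" for X Y Z U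
    unfolding weyl_of_def by (subst th) (simp add: sum_negf)
  moreover have "weyl_of s A X Y Z U = - weyl_of s A X Y U Z" for X Y Z U
    unfolding weyl_of_def by (subst (2) th) (simp add: sum_negf)
  moreover have "weyl_of s A X Y Z U = weyl_of s A Z U X Y" for X Y Z U
    unfolding weyl_of_def sum_3 sym by (simp add: algebra_simps)
  moreover have "weyl_of s A X Y Z U + weyl_of s A Y Z X U + weyl_of s A Z X Y U = 0" for X Y Z U
  proof -
    define K where "K a b = \<theta> s a X Y * \<theta> s b Z U + \<theta> s a Y Z * \<theta> s b X U + \<theta> s a Z X * \<theta> s b Y U" for a b
    obtain V where K: "K a b + K b a = (if a = b then V else 0)" for a b
      using dual_basis_bianchi[of s X Y Z U] unfolding K_def by blast
    have "weyl_of s A X Y Z U + weyl_of s A Y Z X U + weyl_of s A Z X Y U =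
        (\<Sum>a\<in>UNIV. \<Sum>b\<in>UNIV. A a b * K a b)"
      by (simp add: weyl_of_def K_def sum.distrib algebra_simps)
    also have "\<dots> = (A 1 1 * (K 1 1 + K 1 1) + A 2 2 * (K 2 2 + K 2 2) + A 3 3 * (K 3 3 + K 3 3)) / 2
        + A 1 2 * (K 1 2 + K 2 1) + A 1 3 * (K 1 3 + K 3 1) + A 2 3 * (K 2 3 + K 3 2)"
      unfolding sum_3 sym by (simp add: algebra_simps)
    also have "\<dots> = 0" unfolding K by (simp add: tr algebra_simps)
    finally show ?thesis .
  qed
  ultimately show ?thesis unfolding riemann_tensors_def by blast
qed

text \<open>As skew endomorphisms the \<open>\<theta> s a\<close> obey the quaternion relations:
  each squares to -1 and distinct ones anticommute. For symmetric \<open>A\<close> the contraction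
  is thus minus the trace of \<open>A\<close> times the metric.\<close>

lemma weyl_of_weyl:
  assumes "A \<in> sym_traceless" "s \<in> {1, -1}"
  shows "weyl_of s A \<in> weyl_tensors e"
proof -
  have sym: "A 2 1 = A 1 2" "A 3 1 = A 1 3" "A 3 2 = A 2 3" and tr: "A 3 3 = - A 1 1 - A 2 2"
    using assms by (auto simp: sym_traceless_def sum_3)
  have "trace14 e (weyl_of s A) Y Z = 0" for Y Z
    using assms(2) unfolding trace14_def weyl_of_def sum_3 sum_4 sym tr dual_basis_apply
    by (auto simp: wedge_def inner_frame algebra_simps)
  then show ?thesis by (simp add: weyl_tensors_iff weyl_of_riemann assms fun_eq_iff)
qed

lemma weyl_of_dual_form: "weyl_of s A X Y = dual_form s (\<lambda>b. \<Sum>a\<in>UNIV. A a b * \<theta> s a X Y)"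
  unfolding weyl_of_def dual_form_def sum_3 by (intro ext) (simp add: algebra_simps)

lemma dual_coord_zero: "dual_coord s a 0 = 0"
  by (simp add: dual_coord_def)

text \<open>Supplies a left inverse of \<open>weyl_of\<close>, and separates the two signs in a
  sum.\<close>

lemma block_weyl_of:
  assumes "s \<in> {1, -1}" "t \<in> {1, -1}"
  shows "block s s (weyl_of t A) = (if s = t then A else 0)"
proof (intro ext)
  fix a b
  have "(\<lambda>X Y. dual_coord s b (weyl_of t A X Y)) = (if s = t then dual_form t (\<lambda>a. A a b) else 0)"
    by (intro ext) (simp add: weyl_of_dual_form dual_coord_dual_form[OF assms] dual_form_def)
  then show "block s s (weyl_of t A) a b = (if s = t then A else 0) a b"
    by (simp add: block_def dual_coord_dual_form[OF assms(2) assms(2)] dual_coord_zero)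
qed

text \<open>Symmetry is the exchange of pairs. The block trace is a multiple of the scalar curvature
  plus \<open>s\<close> times a multiple of R1234 - R1324 + R1423; the trace condition kills the
  first term and the Bianchi identity the second.\<close>

lemma block_sym_traceless:
  assumes "W \<in> weyl_tensors e" "s \<in> {1, -1}"
  shows "block s s W \<in> sym_traceless"
proof -
  from assms have W: "W \<in> riemann_tensors" by (simp add: weyl_tensors_def)
  have t: "(\<Sum>i\<in>UNIV. W (e i) X Y (e i)) = 0" for X Y
    using assms by (simp add: weyl_tensors_def)
  have "block s s W a b = block s s W b a" for a b
    using exhaust_3[of a] exhaust_3[of b] assms(2)
    by (elim disjE insertE emptyE) (simp_all add: block_def dual_coord_apply riemann_frame[OF W] field_simps)
  moreover have "(\<Sum>a\<in>UNIV. block s s W a a) = 0"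
    using t[of "e 1" "e 1"] t[of "e 2" "e 2"] t[of "e 3" "e 3"] t[of "e 4" "e 4"] assms(2)
    by (auto simp: sum_3 sum_4 block_def dual_coord_apply riemann_frame[OF W] field_simps)
  ultimately show ?thesis by (simp add: sym_traceless_def)
qed

text \<open>
  The nine entries of the mixed block are linear combinations of the components of the Ricci
  tensor.
\<close>

lemma block_mixed:
  assumes "W \<in> weyl_tensors e" "s \<in> {1, -1}"
  shows "block s (- s) W a b = 0"
proof -
  from assms have W: "W \<in> riemann_tensors" by (simp add: weyl_tensors_def)
  have t: "(\<Sum>i\<in>UNIV. W (e i) X Y (e i)) = 0" for X Y
    using assms by (simp add: weyl_tensors_def)
  have t': "W (e 1) X Y (e 1) + W (e 2) X Y (e 2) + W (e 3) X Y (e 3) + W (e 4) X Y (e 4) = 0" for X Y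
    using t[of X Y] by (simp add: sum_4)
  note simps = riemann_frame[OF W]
  have T:
    "W (e 1) (e 2) (e 1) (e 2) + W (e 1) (e 3) (e 1) (e 3) + W (e 1) (e 4) (e 1) (e 4) = 0"
    "W (e 1) (e 2) (e 1) (e 2) + W (e 2) (e 3) (e 2) (e 3) + W (e 2) (e 4) (e 2) (e 4) = 0"
    "W (e 1) (e 3) (e 1) (e 3) + W (e 2) (e 3) (e 2) (e 3) + W (e 3) (e 4) (e 3) (e 4) = 0"
    "W (e 1) (e 4) (e 1) (e 4) + W (e 2) (e 4) (e 2) (e 4) + W (e 3) (e 4) (e 3) (e 4) = 0"
    "W (e 1) (e 3) (e 2) (e 3) + W (e 1) (e 4) (e 2) (e 4) = 0"
    "W (e 1) (e 2) (e 2) (e 3) - W (e 1) (e 4) (e 3) (e 4) = 0"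
    "W (e 1) (e 2) (e 2) (e 4) + W (e 1) (e 3) (e 3) (e 4) = 0"
    "W (e 1) (e 2) (e 1) (e 3) + W (e 2) (e 4) (e 3) (e 4) = 0"
    "W (e 2) (e 3) (e 3) (e 4) - W (e 1) (e 2) (e 1) (e 4) = 0"
    "W (e 1) (e 3) (e 1) (e 4) + W (e 2) (e 3) (e 2) (e 4) = 0"
    using t'[of "e 1" "e 1"] t'[of "e 2" "e 2"] t'[of "e 3" "e 3"] t'[of "e 4" "e 4"]
      t'[of "e 1" "e 2"] t'[of "e 1" "e 3"] t'[of "e 1" "e 4"] t'[of "e 2" "e 3"]
      t'[of "e 2" "e 4"] t'[of "e 3" "e 4"]
    by (simp_all add: simps)
  \<comment> \<open>The first three identities say that complementary planes have equal curvature: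
    adding two of the diagonal equations in \<open>T\<close> and subtracting the other two leaves
    twice the difference. The other six solve the off-diagonal equations.\<close>
  have N:
    "W (e 3) (e 4) (e 3) (e 4) = W (e 1) (e 2) (e 1) (e 2)"
    "W (e 2) (e 4) (e 2) (e 4) = W (e 1) (e 3) (e 1) (e 3)"
    "W (e 1) (e 4) (e 1) (e 4) = W (e 2) (e 3) (e 2) (e 3)"
    "W (e 1) (e 4) (e 2) (e 4) = - W (e 1) (e 3) (e 2) (e 3)"
    "W (e 1) (e 4) (e 3) (e 4) = W (e 1) (e 2) (e 2) (e 3)"
    "W (e 1) (e 3) (e 3) (e 4) = - W (e 1) (e 2) (e 2) (e 4)"
    "W (e 2) (e 4) (e 3) (e 4) = - W (e 1) (e 2) (e 1) (e 3)"
    "W (e 2) (e 3) (e 3) (e 4) = W (e 1) (e 2) (e 1) (e 4)"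
    "W (e 2) (e 3) (e 2) (e 4) = - W (e 1) (e 3) (e 1) (e 4)"
    using T by linarith+
  show ?thesis
    using exhaust_3[of a] exhaust_3[of b] assms(2)
    by (elim disjE insertE emptyE) (simp_all add: block_def dual_coord_apply simps N field_simps)
qed

section \<open>Block expansion of curvature tensors\<close>

lemma two_form_dual_forms:
  assumes "\<omega> \<in> two_forms"
  shows "\<omega> X Y = dual_form 1 (\<lambda>a. dual_coord 1 a \<omega>) X Y + dual_form (-1) (\<lambda>a. dual_coord (-1) a \<omega>) X Y"
  by (subst two_form_expansion[OF assms])
     (simp add: dual_form_def sum_3 dual_basis_apply dual_coord_apply field_simps)

lemma riemann_blocks:
  assumes R: "R \<in> riemann_tensors"
  shows "R X Y Z U = (\<Sum>a\<in>UNIV. \<Sum>b\<in>UNIV.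
     block 1 1 R a b * \<theta> 1 a X Y * \<theta> 1 b Z U + block 1 (-1) R a b * \<theta> 1 a X Y * \<theta> (-1) b Z U +
     block (-1) 1 R a b * \<theta> (-1) a X Y * \<theta> 1 b Z U + block (-1) (-1) R a b * \<theta> (-1) a X Y * \<theta> (-1) b Z U)"
proof -
  have "dual_coord t b (R X Y) =
    dual_form 1 (\<lambda>a. block 1 t R a b) X Y + dual_form (-1) (\<lambda>a. block (-1) t R a b) X Y" for t b
    unfolding block_def by (rule two_form_dual_forms[OF dual_coord_two_form[OF R]])
  then show ?thesis
    by (subst two_form_dual_forms[OF riemann_two_forms(1)[OF R]])
       (simp add: dual_form_def sum_3 algebra_simps)
qed

lemma weyl_dual_parts:
  assumes W: "W \<in> weyl_tensors e"
  shows "W = dual_part e 1 W + dual_part e (-1) W"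
proof -
  have R: "W \<in> riemann_tensors" using W by (simp add: weyl_tensors_def)
  show ?thesis
    using block_mixed[OF W, of 1] block_mixed[OF W, of "-1"]
    by (intro ext, subst riemann_blocks[OF R])
       (simp add: dual_part_riemann[OF R] weyl_of_def fun_apply_simps sum.distrib)
qed

text \<open>The blocks of Weyl tensors are symmetric and traceless. Conversely, each tensor built
  from such a matrix is a Weyl tensor that \<open>dual_part\<close> fixes, so it lies in the
  image.\<close>

lemma weyl_dual_tensors_eq:
  assumes s: "s \<in> {1, -1}"
  shows "weyl_dual_tensors e s = weyl_of s ` sym_traceless"
proof (intro equalityI subsetI)
  fix A assume "A \<in> weyl_dual_tensors e s"
  then obtain W where W: "W \<in> weyl_tensors e" "A = dual_part e s W" by (auto simp: weyl_dual_tensors_def)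
  then have "A = weyl_of s (block s s W)" using dual_part_riemann s by (simp add: weyl_tensors_def)
  then show "A \<in> weyl_of s ` sym_traceless" using block_sym_traceless[OF W(1) s] by blast
next
  fix T assume "T \<in> weyl_of s ` sym_traceless"
  then obtain A where A: "A \<in> sym_traceless" "T = weyl_of s A" by blast
  then have "dual_part e s T = T"
    by (simp add: dual_part_riemann[OF weyl_of_riemann s] block_weyl_of[OF s s])
  moreover have "T \<in> weyl_tensors e" using A weyl_of_weyl s by blast
  ultimately show "T \<in> weyl_dual_tensors e s" unfolding weyl_dual_tensors_def by (metis image_eqI)
qed

section \<open>Traces of Kulkarni-Nomizu products\<close>

lemma linear_frame_sum:
  assumes "linear f"
  shows "(\<Sum>i\<in>UNIV. (Y \<bullet> e i) * f (e i)) = (f Y :: real)"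
proof -
  have "f Y = f (\<Sum>i\<in>UNIV. (Y \<bullet> e i) *\<^sub>R e i)" using frame_expansion[of Y] by simp
  also have "\<dots> = (\<Sum>i\<in>UNIV. (Y \<bullet> e i) * f (e i))"
    using assms by (simp add: linear_sum linear_scale)
  finally show ?thesis by simp
qed

lemma form_trace_inner: "form_trace e inner = 4"
  by (simp add: form_trace_def inner_frame)

text \<open>Two of the four terms contract to \<open>h\<close> each, one gives \<open>- 4\<close>
  times \<open>h\<close> because the metric has trace 4, and one gives the trace of
  \<open>h\<close>; hence -2 = 2 - 4.\<close>

lemma trace14_kulkarni_nomizu:
  assumes "symmetric_form h"
  shows "trace14 e (h \<and>\<^sub>K\<^sub>N inner) = (-2) *\<^sub>R h - form_trace e h *\<^sub>R inner"
proof (intro ext)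
  fix Y Z
  have b: "linear (\<lambda>X. h X Z)" "linear (h Y)"
    using assms by (auto simp: symmetric_form_def bilinear_def)
  show "trace14 e (h \<and>\<^sub>K\<^sub>N inner) Y Z = ((-2) *\<^sub>R h - form_trace e h *\<^sub>R inner) Y Z"
    using linear_frame_sum[OF b(1), of Y] linear_frame_sum[OF b(2), of Z]
    by (simp add: trace14_def kulkarni_nomizu_def form_trace_def fun_apply_simps inner_frame
        sum.distrib sum_subtractf inner_commute mult.commute sum_distrib_left[symmetric])
qed

lemma trace14_metric: "trace14 e (inner \<and>\<^sub>K\<^sub>N inner) = (-6) *\<^sub>R inner"
  unfolding trace14_kulkarni_nomizu[OF symmetric_form_inner] form_trace_inner
  by (intro ext) (simp add: fun_apply_simps)

lemma trace14_weyl: "trace14 e W = 0" if "W \<in> weyl_tensors e"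
  using that weyl_tensors_iff[of W] by (auto simp: weyl_tensors_def)

lemma symmetric_form_trace14:
  assumes R: "R \<in> riemann_tensors"
  shows "symmetric_form (trace14 e R)"
proof -
  have "trace14 e R Y Z = trace14 e R Z Y" for Y Z
  proof -
    \<comment> \<open>Flip both pairs, then exchange them.\<close>
    have "R (e i) Y Z (e i) = R (e i) Z Y (e i)" for i
      using riemann_tensorsD(2)[OF R, of "e i" Y Z "e i"] riemann_tensorsD(3)[OF R, of Y "e i" Z "e i"]
        riemann_tensorsD(4)[OF R, of Y "e i" "e i" Z] by simp
    then show ?thesis by (simp add: trace14_def)
  qed
  moreover have "bilinear (trace14 e R)"
    using riemann_tensorsD(1)[OF R]
    by (auto simp: bilinear_def trace14_def multilinear4_def intro!: linear_compose_sum)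
  ultimately show ?thesis by (simp add: symmetric_form_def)
qed

lemma subspace_weyl_tensors: "subspace (weyl_tensors e)"
proof -
  have "weyl_tensors e = riemann_tensors \<inter> {R. trace14 e R = 0}"
    using weyl_tensors_iff by (auto simp: weyl_tensors_def)
  moreover have "subspace {R. trace14 e R = 0}"
    by (rule subspaceI) (auto simp: trace14_add trace14_scale, simp add: trace14_def fun_eq_iff)
  ultimately show ?thesis using subspace_riemann_tensors subspace_inter by metis
qed

section \<open>Dimensions and independence of the two Weyl parts\<close>

lemma linear_weyl_of: "linear (weyl_of s)"
  by (intro linearI ext) (simp_all add: weyl_of_def fun_apply_simps algebra_simps sum.distrib sum_distrib_left)

lemma block_add: "block s t (R + S) = block s t R + block s t S"
  by (intro ext) (simp add: block_def dual_coord_def fun_apply_simps field_simps)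

lemma block_zero: "block s t 0 = 0"
  by (intro ext) (simp add: block_def dual_coord_def)

lemma inj_weyl_of: "inj (weyl_of s)" if "s \<in> {1, -1}"
  by (rule injI) (metis block_weyl_of[OF that that])

lemma weyl_dual_tensors_range:
  "s \<in> {1, -1} \<Longrightarrow> weyl_dual_tensors e s = range (weyl_of s \<circ> traceless3)"
  by (simp only: weyl_dual_tensors_eq image_comp[symmetric] traceless3_range)

lemma linear_weyl_param: "linear (weyl_of s \<circ> traceless3)"
  by (rule linear_compose[OF linear_traceless3 linear_weyl_of])

lemma subspace_weyl_dual_tensors: "subspace (weyl_dual_tensors e s)" if "s \<in> {1, -1}"
  unfolding weyl_dual_tensors_range[OF that]
  by (rule linear_subspace_image[OF linear_weyl_param subspace_UNIV])

lemma dim_weyl_dual_tensors: "dim (weyl_dual_tensors e s) = 5" if "s \<in> {1, -1}"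
  unfolding weyl_dual_tensors_range[OF that]
  by (subst dim_range_inj[OF linear_weyl_param inj_compose[OF inj_weyl_of[OF that] inj_traceless3]]) simp

lemma weyl_dual_tensors_weyl: "s \<in> {1, -1} \<Longrightarrow> weyl_dual_tensors e s \<subseteq> weyl_tensors e"
  using weyl_of_weyl by (auto simp: weyl_dual_tensors_eq)

lemma weyl_dual_tensors_indep:
  assumes "A \<in> weyl_dual_tensors e 1" "B \<in> weyl_dual_tensors e (-1)" "A + B = 0"
  shows "A = 0 \<and> B = 0"
proof -
  obtain P Q where PQ: "A = weyl_of 1 P" "B = weyl_of (-1) Q"
    using assms by (auto simp: weyl_dual_tensors_eq)
  have "block 1 1 (A + B) = P" "block (-1) (-1) (A + B) = Q"
    unfolding block_add PQ by (simp_all add: block_weyl_of)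
  then have "P = 0" "Q = 0"
    unfolding assms(3) by (simp_all add: block_zero)
  then show ?thesis using linear_0[OF linear_weyl_of] by (simp add: PQ)
qed

lemma weyl_direct_sum:
  "internal_direct_sum (weyl_tensors e) [weyl_dual_tensors e 1, weyl_dual_tensors e (-1)]"
proof (rule internal_direct_sum2I)
  fix W assume "W \<in> weyl_tensors e"
  then show "\<exists>a\<in>weyl_dual_tensors e 1. \<exists>b\<in>weyl_dual_tensors e (-1). W = a + b"
    using weyl_dual_parts unfolding weyl_dual_tensors_def by blast
qed (simp_all add: subspace_weyl_tensors subspace_weyl_dual_tensors weyl_dual_tensors_weyl weyl_dual_tensors_indep)

section \<open>Invariance of the eigenspaces and orthogonality\<close>

lemma curvature_operator_weyl_of:
  assumes "A \<in> sym_traceless" "s \<in> {1, -1}" "t \<in> {1, -1}"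
  shows "curvature_operator e (weyl_of t A) (dual_form s c) =
    (if s = t then dual_form s (\<lambda>a. 2 * (\<Sum>b\<in>UNIV. A a b * c b)) else 0)"
  by (intro ext)
     (simp add: curvature_operator_dual_form[OF weyl_of_riemann[OF assms(1)]] weyl_of_dual_form
       dual_coord_dual_form[OF assms(2,3)], simp add: dual_form_def sum_3 algebra_simps)

lemma curvature_operator_add: "curvature_operator e (R + S) \<omega> = curvature_operator e R \<omega> + curvature_operator e S \<omega>"
  by (intro ext) (simp add: curvature_operator_def fun_apply_simps distrib_right sum.distrib add_divide_distrib)

text \<open>Of the two summands of \<open>W\<close>, the one of sign \<open>s\<close> maps the
  eigenspace into itself and the other annihilates it.\<close>

lemma curvature_operator_dual_forms:
  assumes W: "W \<in> weyl_tensors e" and s: "s \<in> {1, -1}"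
  shows "curvature_operator e W ` dual_forms e s \<subseteq> dual_forms e s"
proof -
  have R: "W \<in> riemann_tensors" using W by (simp add: weyl_tensors_def)
  have W_eq: "W = weyl_of 1 (block 1 1 W) + weyl_of (-1) (block (-1) (-1) W)"
    using weyl_dual_parts[OF W] by (simp add: dual_part_riemann[OF R])
  have 0: "0 \<in> dual_forms e s" using subspace_dual_forms[OF s] by (rule subspace_0)
  have "curvature_operator e (weyl_of t (block t t W)) (dual_form s c) \<in> dual_forms e s"
    if t: "t \<in> {1, -1}" for c t
    unfolding curvature_operator_weyl_of[OF block_sym_traceless[OF W t] s t]
    using 0 by (simp add: dual_forms_eq[OF s])
  from this[of 1] this[of "-1"] have "curvature_operator e W (dual_form s c) \<in> dual_forms e s" for c
    by (subst W_eq, subst curvature_operator_add, intro subspace_add[OF subspace_dual_forms[OF s]]) auto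
  then show ?thesis unfolding dual_forms_eq[OF s] by blast
qed

lemma dual_form_orthogonal:
  "(\<Sum>i\<in>UNIV. \<Sum>j\<in>UNIV. dual_form 1 c (e i) (e j) * dual_form (-1) d (e i) (e j)) = 0"
  by (simp add: sum_4 dual_form_def sum_3 dual_basis_apply wedge_frame)

text \<open>With the first two slots fixed, both tensors are forms of opposite duality in the last
  two, so the inner double sum already vanishes.\<close>

lemma weyl_dual_tensors_orthogonal:
  assumes "A \<in> weyl_dual_tensors e 1" "B \<in> weyl_dual_tensors e (-1)"
  shows "tensor_inner e A B = 0"
  using assms unfolding tensor_inner_def
  by (auto simp: weyl_dual_tensors_eq weyl_of_dual_form dual_form_orthogonal)

section \<open>The Ricci decomposition\<close>

text \<open>A symmetric matrix of size 4 in the frame has ten entries; vanishing trace forces the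
  coefficient of the fourth square, leaving nine.\<close>

definition traceless4 :: "real \<times> real \<times> real \<times> real \<times> real \<times> real \<times> real \<times> real \<times> real \<Rightarrow> 'a tensor2"
  where "traceless4 = (\<lambda>(p, q, r, a, b, c, x, y, z) X Y.
    p * ((X \<bullet> e 1) * (Y \<bullet> e 1)) + q * ((X \<bullet> e 2) * (Y \<bullet> e 2)) + r * ((X \<bullet> e 3) * (Y \<bullet> e 3))
    - (p + q + r) * ((X \<bullet> e 4) * (Y \<bullet> e 4))
    + a * ((X \<bullet> e 1) * (Y \<bullet> e 2) + (X \<bullet> e 2) * (Y \<bullet> e 1))
    + b * ((X \<bullet> e 1) * (Y \<bullet> e 3) + (X \<bullet> e 3) * (Y \<bullet> e 1))
    + c * ((X \<bullet> e 1) * (Y \<bullet> e 4) + (X \<bullet> e 4) * (Y \<bullet> e 1))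
    + x * ((X \<bullet> e 2) * (Y \<bullet> e 3) + (X \<bullet> e 3) * (Y \<bullet> e 2))
    + y * ((X \<bullet> e 2) * (Y \<bullet> e 4) + (X \<bullet> e 4) * (Y \<bullet> e 2))
    + z * ((X \<bullet> e 3) * (Y \<bullet> e 4) + (X \<bullet> e 4) * (Y \<bullet> e 3)))"

lemma traceless4_range: "range traceless4 = {h. symmetric_form h \<and> form_trace e h = 0}"
proof (intro equalityI subsetI)
  fix h :: "'a tensor2" assume "h \<in> {h. symmetric_form h \<and> form_trace e h = 0}"
  then have b: "bilinear h" and s: "\<And>X Y. h X Y = h Y X" and t: "form_trace e h = 0"
    by (auto simp: symmetric_form_def)
  have t': "h (e 4) (e 4) = - (h (e 1) (e 1) + h (e 2) (e 2) + h (e 3) (e 3))"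
    using t by (simp add: form_trace_def sum_4)
  have "h X Y = traceless4 (h (e 1) (e 1), h (e 2) (e 2), h (e 3) (e 3), h (e 1) (e 2), h (e 1) (e 3),
      h (e 1) (e 4), h (e 2) (e 3), h (e 2) (e 4), h (e 3) (e 4)) X Y" for X Y
    by (subst form_expansion[OF b], simp only: sum_4 t' s[of "e 2" "e 1"] s[of "e 3" "e 1"]
        s[of "e 4" "e 1"] s[of "e 3" "e 2"] s[of "e 4" "e 2"] s[of "e 4" "e 3"])
      (simp add: traceless4_def algebra_simps)
  then show "h \<in> range traceless4" by (metis (no_types) ext rangeI)
next
  fix h assume "h \<in> range traceless4"
  then show "h \<in> {h. symmetric_form h \<and> form_trace e h = 0}"
    by (auto simp: traceless4_def symmetric_form_def bilinear_def linear_iff form_trace_def sum_4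
        inner_frame inner_add_left algebra_simps)
qed

lemma traceless4_symmetric_form: "symmetric_form (traceless4 v)" "form_trace e (traceless4 v) = 0"
  using traceless4_range by auto

lemma linear_traceless4: "linear traceless4"
  by (intro linearI ext) (auto simp: traceless4_def fun_apply_simps algebra_simps)

lemma inj_traceless4: "inj traceless4"
proof (rule injI)
  fix v w assume "traceless4 v = traceless4 w"
  then have "traceless4 v X Y = traceless4 w X Y" for X Y by simp
  from this[of "e 1" "e 1"] this[of "e 2" "e 2"] this[of "e 3" "e 3"] this[of "e 1" "e 2"]
    this[of "e 1" "e 3"] this[of "e 1" "e 4"] this[of "e 2" "e 3"] this[of "e 2" "e 4"] this[of "e 3" "e 4"]
  show "v = w" by (simp add: traceless4_def inner_frame split: prod.splits)
qed

definition ricci_param where "ricci_param v = traceless4 v \<and>\<^sub>K\<^sub>N (inner :: 'a tensor2)"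

lemma traceless_ricci_range: "traceless_ricci_part e = range ricci_param"
proof -
  have "traceless_ricci_part e = (\<lambda>h. h \<and>\<^sub>K\<^sub>N inner) ` range traceless4"
    unfolding traceless_ricci_part_def traceless4_range by blast
  then show ?thesis by (simp add: ricci_param_def image_image)
qed

lemma linear_ricci_param: "linear ricci_param"
  using linear_traceless4
  by (intro linearI) (simp_all add: ricci_param_def linear_add linear_scale kulkarni_nomizu_add kulkarni_nomizu_scale)

lemma trace14_ricci_param: "trace14 e (ricci_param v) = (-2) *\<^sub>R traceless4 v"
  unfolding ricci_param_def trace14_kulkarni_nomizu[OF traceless4_symmetric_form(1)] traceless4_symmetric_form
  by simp

text \<open>tr14 recovers the traceless form up to the factor -2.\<close>

lemma inj_ricci_param: "inj ricci_param"
proof (rule injI)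
  fix v w assume "ricci_param v = ricci_param w"
  then have "(-2) *\<^sub>R traceless4 v = (-2) *\<^sub>R traceless4 w"
    using trace14_ricci_param by metis
  then have "traceless4 v = traceless4 w" by simp
  then show "v = w" using inj_traceless4 by (simp add: inj_eq)
qed

text \<open>tr14 kills \<open>A\<close> and \<open>B\<close>. In what remains the traceless form
  disappears under a second trace, where the metric contributes 4; this gives \<open>c = 0\<close>,
  then \<open>v = 0\<close>, and the blocks separate \<open>A\<close> from \<open>B\<close>.\<close>

lemma curvature_indep:
  assumes "c *\<^sub>R (inner \<and>\<^sub>K\<^sub>N inner) + ricci_param v + A + B = 0"
    and A: "A \<in> weyl_dual_tensors e 1" and B: "B \<in> weyl_dual_tensors e (-1)"
  shows "c = 0 \<and> v = 0 \<and> A = 0 \<and> B = 0"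
proof -
  have "trace14 e A = 0" "trace14 e B = 0"
    using A B weyl_dual_tensors_weyl trace14_weyl by blast+
  moreover have "trace14 e (c *\<^sub>R (inner \<and>\<^sub>K\<^sub>N inner) + ricci_param v + A + B) = 0"
    unfolding assms(1) by (intro ext) (simp add: trace14_def)
  ultimately have t: "(c * (-6)) *\<^sub>R inner + (-2) *\<^sub>R traceless4 v = 0"
    by (simp add: trace14_add trace14_scale trace14_metric trace14_ricci_param)
  have "form_trace e ((c * (-6)) *\<^sub>R inner + (-2) *\<^sub>R traceless4 v) = 0"
    unfolding t by (simp add: form_trace_def)
  then have c: "c = 0"
    by (simp add: form_trace_add form_trace_scale form_trace_inner traceless4_symmetric_form del: scaleR_minus_left)
  with t have "traceless4 v = traceless4 0" using linear_0[OF linear_traceless4] by simp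
  then have v: "v = 0" using inj_traceless4 by (simp add: inj_eq)
  have "A + B = 0" using assms(1) linear_0[OF linear_ricci_param] by (simp add: c v)
  with weyl_dual_tensors_indep[OF A B] c v show ?thesis by simp
qed

text \<open>Subtracting the scalar and Ricci terms with the same tr14 as \<open>R\<close> leaves a
  tensor with tr14 = 0, which is Weyl and splits by duality.\<close>

lemma curvature_decomposition:
  assumes R: "R \<in> riemann_tensors"
  obtains c v A B where "R = c *\<^sub>R (inner \<and>\<^sub>K\<^sub>N inner) + ricci_param v + A + B"
    "A \<in> weyl_dual_tensors e 1" "B \<in> weyl_dual_tensors e (-1)"
proof -
  \<comment> \<open>The values are forced by \<open>trace14 e R = - 6 c g - 2 h\<close> with \<open>h\<close> traceless.\<close>
  define c where "c = - form_trace e (trace14 e R) / 24"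
  define h where "h = (-1/2) *\<^sub>R (trace14 e R + (6 * c) *\<^sub>R inner)"
  have "symmetric_form h"
    using subspace_symmetric_form symmetric_form_trace14[OF R] symmetric_form_inner
    unfolding h_def by (metis mem_Collect_eq subspace_add subspace_scale)
  moreover have "form_trace e h = 0"
    unfolding h_def form_trace_scale form_trace_add form_trace_inner c_def by simp
  ultimately obtain v where v: "h = traceless4 v" using traceless4_range by blast
  define W where "W = R - (c *\<^sub>R (inner \<and>\<^sub>K\<^sub>N inner) + ricci_param v)"
  have R_eq: "R = (c *\<^sub>R (inner \<and>\<^sub>K\<^sub>N inner) + ricci_param v) + W" by (simp add: W_def)
  have "ricci_param v \<in> riemann_tensors" unfolding ricci_param_def
    by (intro kulkarni_nomizu_riemann traceless4_symmetric_form symmetric_form_inner)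
  then have W: "W \<in> riemann_tensors" unfolding W_def
    by (intro subspace_diff[OF subspace_riemann_tensors] R subspace_add[OF subspace_riemann_tensors]
        subspace_scale[OF subspace_riemann_tensors] kulkarni_nomizu_riemann symmetric_form_inner)
  have "trace14 e R = c *\<^sub>R (-6) *\<^sub>R inner + (-2) *\<^sub>R h + trace14 e W"
    by (subst R_eq) (simp only: trace14_add trace14_scale trace14_metric trace14_ricci_param v)
  then have "trace14 e W = 0"
    by (simp add: h_def fun_eq_iff fun_apply_simps field_simps)
  then have "W \<in> weyl_tensors e" by (simp add: weyl_tensors_iff[OF W])
  then obtain A B where "A \<in> weyl_dual_tensors e 1" "B \<in> weyl_dual_tensors e (-1)" "W = A + B"
    using weyl_dual_parts unfolding weyl_dual_tensors_def by blast
  with R_eq that show ?thesis by (metis add.assoc)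
qed

section \<open>Direct sum and dimension of the space of curvature tensors\<close>

lemma scalar_part_range: "scalar_part = range (\<lambda>c::real. c *\<^sub>R (inner \<and>\<^sub>K\<^sub>N (inner :: 'a tensor2)))"
  unfolding scalar_part_def by auto

lemma linear_scalar_param: "linear (\<lambda>c::real. c *\<^sub>R (inner \<and>\<^sub>K\<^sub>N (inner :: 'a tensor2)))"
  by (intro linearI) (simp_all add: scaleR_add_left)

lemma dim_scalar_part: "dim (scalar_part :: 'a tensor4 set) = 1"
proof -
  have "inner \<and>\<^sub>K\<^sub>N inner \<noteq> (0 :: 'a tensor4)"
  proof
    assume "inner \<and>\<^sub>K\<^sub>N inner = (0 :: 'a tensor4)"
    then have "(inner \<and>\<^sub>K\<^sub>N inner) (e 1) (e 2) (e 1) (e 2) = 0" by simp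
    then show False by (simp add: kulkarni_nomizu_def inner_frame)
  qed
  then have "inj (\<lambda>c::real. c *\<^sub>R (inner \<and>\<^sub>K\<^sub>N (inner :: 'a tensor2)))"
    by (intro injI) simp
  then show ?thesis using dim_range_inj[OF linear_scalar_param] by (simp add: scalar_part_range)
qed

lemma dim_traceless_ricci_part: "dim (traceless_ricci_part e) = 9"
  unfolding traceless_ricci_range
  by (subst dim_range_inj[OF linear_ricci_param inj_ricci_param]) simp

lemma scalar_part_riemann: "scalar_part \<subseteq> (riemann_tensors :: 'a tensor4 set)"
  unfolding scalar_part_range
  using kulkarni_nomizu_riemann[OF symmetric_form_inner symmetric_form_inner]
  by (auto intro: subspace_scale[OF subspace_riemann_tensors])

lemma traceless_ricci_part_riemann: "traceless_ricci_part e \<subseteq> riemann_tensors"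
  unfolding traceless_ricci_part_def using kulkarni_nomizu_riemann symmetric_form_inner by blast

lemma weyl_dual_tensors_riemann: "s \<in> {1, -1} \<Longrightarrow> weyl_dual_tensors e s \<subseteq> riemann_tensors"
  using weyl_dual_tensors_weyl by (fastforce simp: weyl_tensors_def)

lemma riemann_direct_sum:
  "internal_direct_sum (riemann_tensors :: 'a tensor4 set)
    [scalar_part, traceless_ricci_part e, weyl_dual_tensors e 1, weyl_dual_tensors e (-1)]"
proof (rule internal_direct_sumI)
  fix R :: "'a tensor4" assume "R \<in> riemann_tensors"
  then obtain c v A B where "R = c *\<^sub>R (inner \<and>\<^sub>K\<^sub>N inner) + ricci_param v + A + B"
    "A \<in> weyl_dual_tensors e 1" "B \<in> weyl_dual_tensors e (-1)" by (rule curvature_decomposition)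
  then show "\<exists>xs. list_all2 (\<in>) xs [scalar_part, traceless_ricci_part e, weyl_dual_tensors e 1,
      weyl_dual_tensors e (-1)] \<and> sum_list xs = R"
    by (intro exI[of _ "[c *\<^sub>R (inner \<and>\<^sub>K\<^sub>N inner), ricci_param v, A, B]"])
       (auto simp: scalar_part_def traceless_ricci_range add.assoc)
next
  fix xs assume xs: "list_all2 (\<in>) xs [scalar_part, traceless_ricci_part e, weyl_dual_tensors e 1,
      weyl_dual_tensors e (-1)]" "sum_list xs = 0"
  then obtain S T A B where "xs = [S, T, A, B]" "S \<in> scalar_part" "T \<in> traceless_ricci_part e"
    and AB: "A \<in> weyl_dual_tensors e 1" "B \<in> weyl_dual_tensors e (-1)"
    by (auto simp: list_all2_Cons2)
  moreover from this obtain c v where "S = c *\<^sub>R (inner \<and>\<^sub>K\<^sub>N inner)" "T = ricci_param v"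
    unfolding scalar_part_range traceless_ricci_range by blast
  ultimately have "xs = [c *\<^sub>R (inner \<and>\<^sub>K\<^sub>N inner), ricci_param v, A, B]" by simp
  with xs(2) curvature_indep[OF _ AB, of c v] linear_0[OF linear_ricci_param] show "\<forall>x\<in>set xs. x = 0"
    by (auto simp: add.assoc)
qed (use subspace_riemann_tensors scalar_part_riemann traceless_ricci_part_riemann
    weyl_dual_tensors_riemann[of 1] weyl_dual_tensors_riemann[of "-1"]
    subspace_weyl_dual_tensors[of 1] subspace_weyl_dual_tensors[of "-1"]
    linear_subspace_image[OF linear_scalar_param subspace_UNIV]
    linear_subspace_image[OF linear_ricci_param subspace_UNIV]
    in \<open>auto simp: scalar_part_range traceless_ricci_range\<close>)

text \<open>The four parametrisations add up to a single linear map \<open>F\<close> on a space of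
  dimension 1 + 9 + 5 + 5; \<open>curvature_indep\<close> makes it injective and
  \<open>curvature_decomposition\<close> makes it onto.\<close>

lemma dim_riemann_tensors: "dim (riemann_tensors :: 'a tensor4 set) = 20"
proof -
  define F where "F u = fst u *\<^sub>R (inner \<and>\<^sub>K\<^sub>N (inner :: 'a tensor2)) + ricci_param (fst (snd u))
    + (weyl_of 1 \<circ> traceless3) (fst (snd (snd u))) + (weyl_of (-1) \<circ> traceless3) (snd (snd (snd u)))" for u
  have mem: "(weyl_of 1 \<circ> traceless3) a \<in> weyl_dual_tensors e 1"
    "(weyl_of (-1) \<circ> traceless3) a \<in> weyl_dual_tensors e (-1)" for a
    by (simp_all add: weyl_dual_tensors_range)
  have "linear F"
    by (intro linearI)
       (simp_all add: F_def linear_add[OF linear_ricci_param] linear_add[OF linear_weyl_param]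
        linear_scale[OF linear_ricci_param] linear_scale[OF linear_weyl_param] scaleR_add_left
        scaleR_add_right add_ac del: comp_apply)
  moreover have "inj F"
  proof -
    have "u = 0" if "F u = 0" for u
    proof -
      obtain c v a b where u: "u = (c, v, a, b)" by (cases u) auto
      have 0: "c = 0 \<and> v = 0 \<and> (weyl_of 1 \<circ> traceless3) a = 0 \<and> (weyl_of (-1) \<circ> traceless3) b = 0"
        using that by (intro curvature_indep mem) (simp add: F_def u)
      have "inj (weyl_of s \<circ> traceless3)" if "s \<in> {1, -1}" for s
        using that inj_compose[OF inj_weyl_of inj_traceless3] by blast
      then have "a = 0" "b = 0"
        using 0 linear_injective_0[OF linear_weyl_param] by blast+
      with 0 show ?thesis by (simp add: u zero_prod_def)
    qed
    then show ?thesis using linear_injective_0[OF \<open>linear F\<close>] by blast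
  qed
  moreover have "range F = riemann_tensors"
  proof (intro equalityI subsetI)
    fix R assume "R \<in> range F"
    then obtain c v a b where "R = F (c, v, a, b)" by auto
    moreover have "c *\<^sub>R (inner \<and>\<^sub>K\<^sub>N (inner :: 'a tensor2)) \<in> riemann_tensors" "ricci_param v \<in> riemann_tensors"
      "(weyl_of 1 \<circ> traceless3) a \<in> riemann_tensors" "(weyl_of (-1) \<circ> traceless3) b \<in> riemann_tensors"
      using scalar_part_riemann traceless_ricci_part_riemann
        subsetD[OF weyl_dual_tensors_riemann mem(1)] subsetD[OF weyl_dual_tensors_riemann mem(2)]
      unfolding scalar_part_range traceless_ricci_range by (blast | simp)+
    ultimately show "R \<in> riemann_tensors"
      by (simp add: F_def subspace_add[OF subspace_riemann_tensors])
  next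
    fix R :: "'a tensor4" assume "R \<in> riemann_tensors"
    then obtain c v A B where R: "R = c *\<^sub>R (inner \<and>\<^sub>K\<^sub>N inner) + ricci_param v + A + B"
      and "A \<in> weyl_dual_tensors e 1" "B \<in> weyl_dual_tensors e (-1)" by (rule curvature_decomposition)
    then obtain a b where "A = (weyl_of 1 \<circ> traceless3) a" "B = (weyl_of (-1) \<circ> traceless3) b"
      by (auto simp: weyl_dual_tensors_range)
    then have "R = F (c, v, a, b)" by (simp add: F_def R)
    then show "R \<in> range F" by blast
  qed
  ultimately show ?thesis using dim_range_inj[of F] by simp
qed

end

theorem theorem8p1:
  fixes e :: "4 \<Rightarrow> 'a::euclidean_space"
  assumes "DIM('a) = 4" and "orthonormal_frame e"
  shows
   "(\<comment> \<open>(i)\<close>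
     \<forall>h k :: 'a tensor2. symmetric_form h \<and> symmetric_form k \<longrightarrow> h \<and>\<^sub>K\<^sub>N k = k \<and>\<^sub>K\<^sub>N h) \<and>
    (\<comment> \<open>(ii)\<close>
     \<forall>h k :: 'a tensor2. symmetric_form h \<and> symmetric_form k \<longrightarrow> h \<and>\<^sub>K\<^sub>N k \<in> riemann_tensors) \<and>
    (\<comment> \<open>(iii)\<close>
     internal_direct_sum (riemann_tensors :: 'a tensor4 set)
       [scalar_part, traceless_ricci_part e, weyl_dual_tensors e 1, weyl_dual_tensors e (-1)] \<and>
     dim (riemann_tensors :: 'a tensor4 set) = 20 \<and>
     dim (scalar_part :: 'a tensor4 set) = 1 \<and>
     dim (traceless_ricci_part e) = 9 \<and>
     dim (weyl_dual_tensors e 1) = 5 \<and>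
     dim (weyl_dual_tensors e (-1)) = 5) \<and>
    (\<comment> \<open>(iv)\<close>
     internal_direct_sum (two_forms :: 'a tensor2 set) [dual_forms e 1, dual_forms e (-1)] \<and>
     dim (dual_forms e 1) = 3 \<and>
     dim (dual_forms e (-1)) = 3 \<and>
     internal_direct_sum (weyl_tensors e) [weyl_dual_tensors e 1, weyl_dual_tensors e (-1)] \<and>
     (\<forall>W\<in>weyl_tensors e. \<forall>s\<in>{1, -1}.
        curvature_operator e W ` dual_forms e s \<subseteq> dual_forms e s) \<and>
     (\<forall>W\<in>weyl_tensors e. W = dual_part e 1 W + dual_part e (-1) W) \<and>
     (\<forall>A\<in>weyl_dual_tensors e 1. \<forall>B\<in>weyl_dual_tensors e (-1). tensor_inner e A B = 0)) \<and>
    (\<comment> \<open>(v)\<close>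
     trace14 e (\<g> \<and>\<^sub>K\<^sub>N \<g>) = (-6) *\<^sub>R \<g>) \<and>
    (\<comment> \<open>(vi)\<close>
     \<forall>h. symmetric_form h \<and> form_trace e h = 0 \<longrightarrow>
       trace14 e (h \<and>\<^sub>K\<^sub>N \<g>) = (-2) *\<^sub>R h) \<and>
    (\<comment> \<open>(vii)\<close>
     \<forall>h. symmetric_form h \<longrightarrow>
       trace14 e (h \<and>\<^sub>K\<^sub>N \<g>) = (-2) *\<^sub>R h - form_trace e h *\<^sub>R \<g>)"
proof -
  interpret oriented_frame e by standard fact+
  have traceless: "trace14 e (h \<and>\<^sub>K\<^sub>N inner) = (-2) *\<^sub>R h"
    if "symmetric_form h" "form_trace e h = 0" for h
    using trace14_kulkarni_nomizu[OF that(1)] that(2) by simp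
  \<comment> \<open>Discharges the sign premises of the dimension lemmas beforehand, so that
    applying them as rules leaves no open goal.\<close>
  have s: "(1::real) \<in> {1, -1}" "(-1::real) \<in> {1, -1}" by simp_all
  show ?thesis
    by (intro conjI allI ballI impI)
       (erule conjE | assumption | rule kulkarni_nomizu_commute kulkarni_nomizu_riemann
          riemann_direct_sum dim_riemann_tensors dim_scalar_part dim_traceless_ricci_part
          dim_weyl_dual_tensors[OF s(1)] dim_weyl_dual_tensors[OF s(2)]
          two_forms_direct_sum dim_dual_forms[OF s(1)] dim_dual_forms[OF s(2)] weyl_direct_sum
          curvature_operator_dual_forms weyl_dual_parts weyl_dual_tensors_orthogonal
          trace14_metric trace14_kulkarni_nomizu traceless)+
qed

end
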